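(* For every $r=4t$ with $r=40$ or $r\ge68$, there exists a binary linear $[n,n-r,3]_2 4,3$ code with $n=2943\cdot2^{t-10}-1$. Consequently $\ell_2(4t,4)\le 2943\cdot2^{t-10}-1$ for $t=10$ and $t\ge17$, and the covering densities $\mu=2^{-r}\sum_{i=0}^4\binom ni$ of these codes tend to $2943^4/(3\cdot2^{43})\approx2.8428$ as $t\to\infty$.
   Context: An $[n,n-r,d]_2R,\ell$ code is a binary linear code of length $n$, codimension $r$, minimum distance $d$, covering radius $R$ (smallest $R$ such that every vector of $\mathbb{F}_2^r$ is a sum of at most $R$ columns of a parity-check matrix $H$), such that some parity-check matrix $H$ admits an $(R,\ell)$-partition: a partition of its columns into nonempty subsets such that every vector of $\mathbb{F}_2^r$ (including zero) is the sum of at least $\ell$ and at most $R$ columns lying in pairwise distinct subsets. $\ell_2(r,R)$ is the smallest length of a binary linear code of codimension $r$ and covering radius $R$. *)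

theory Defs
  imports Complex_Main
begin

text \<open>Binary vectors of \<open>F_2^r\<close> are modelled as functions \<open>nat \<Rightarrow> bool\<close>
  vanishing outside \<open>{0..<r}\<close>; addition is XOR.  A parity-check matrix with
  \<open>r\<close> rows and \<open>n\<close> columns is \<open>H :: nat \<Rightarrow> nat \<Rightarrow> bool\<close>, where \<open>H j\<close> is
  column \<open>j\<close> (for \<open>j < n\<close>) and \<open>H j i\<close> is its entry in row \<open>i\<close>.\<close>

definition vecs :: "nat \<Rightarrow> (nat \<Rightarrow> bool) set" where
  "vecs r = {v. \<forall>i. r \<le> i \<longrightarrow> \<not> v i}"

definition zero_vec :: "nat \<Rightarrow> bool" where
  "zero_vec = (\<lambda>_. False)"

definition colsum :: "(nat \<Rightarrow> nat \<Rightarrow> bool) \<Rightarrow> nat set \<Rightarrow> nat \<Rightarrow> bool" where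
  "colsum H S = (\<lambda>i. odd (card {j \<in> S. H j i}))"

text \<open>\<open>H\<close> is an \<open>r \<times> n\<close> binary matrix of rank \<open>r\<close> (columns span \<open>F_2^r\<close>),
  i.e. a parity-check matrix of a binary linear code of length \<open>n\<close> and codimension \<open>r\<close>.\<close>
definition parity_check :: "(nat \<Rightarrow> nat \<Rightarrow> bool) \<Rightarrow> nat \<Rightarrow> nat \<Rightarrow> bool" where
  "parity_check H n r \<longleftrightarrow>
     (\<forall>j<n. H j \<in> vecs r) \<and> (\<forall>v\<in>vecs r. \<exists>S\<subseteq>{..<n}. colsum H S = v)"

text \<open>Minimum distance \<open>d\<close>: the minimum weight of a nonzero codeword, i.e. the least
  size of a nonempty set of columns summing to zero.\<close>
definition has_min_dist :: "(nat \<Rightarrow> nat \<Rightarrow> bool) \<Rightarrow> nat \<Rightarrow> nat \<Rightarrow> bool" where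
  "has_min_dist H n d \<longleftrightarrow>
     (\<forall>S\<subseteq>{..<n}. S \<noteq> {} \<and> colsum H S = zero_vec \<longrightarrow> d \<le> card S) \<and>
     (\<exists>S\<subseteq>{..<n}. S \<noteq> {} \<and> card S = d \<and> colsum H S = zero_vec)"

definition covers :: "(nat \<Rightarrow> nat \<Rightarrow> bool) \<Rightarrow> nat \<Rightarrow> nat \<Rightarrow> nat \<Rightarrow> bool" where
  "covers H n r R \<longleftrightarrow> (\<forall>v\<in>vecs r. \<exists>S\<subseteq>{..<n}. card S \<le> R \<and> colsum H S = v)"

definition has_covering_radius :: "(nat \<Rightarrow> nat \<Rightarrow> bool) \<Rightarrow> nat \<Rightarrow> nat \<Rightarrow> nat \<Rightarrow> bool" where
  "has_covering_radius H n r R \<longleftrightarrow> covers H n r R \<and> (\<forall>R'<R. \<not> covers H n r R')"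

definition is_partition_of :: "nat set set \<Rightarrow> nat set \<Rightarrow> bool" where
  "is_partition_of P A \<longleftrightarrow>
     (\<forall>B\<in>P. B \<noteq> {}) \<and> (\<forall>B\<in>P. \<forall>B'\<in>P. B \<noteq> B' \<longrightarrow> B \<inter> B' = {}) \<and> \<Union>P = A"

definition RL_partition ::
  "(nat \<Rightarrow> nat \<Rightarrow> bool) \<Rightarrow> nat \<Rightarrow> nat \<Rightarrow> nat \<Rightarrow> nat \<Rightarrow> nat set set \<Rightarrow> bool" where
  "RL_partition H n r R l P \<longleftrightarrow> is_partition_of P {..<n} \<and>
     (\<forall>v\<in>vecs r. \<exists>S\<subseteq>{..<n}. l \<le> card S \<and> card S \<le> R \<and> colsum H S = v \<and>
        (\<forall>j\<in>S. \<forall>k\<in>S. j \<noteq> k \<longrightarrow> \<not> (\<exists>B\<in>P. j \<in> B \<and> k \<in> B)))"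

definition is_code_RL :: "(nat \<Rightarrow> nat \<Rightarrow> bool) \<Rightarrow> nat \<Rightarrow> nat \<Rightarrow> nat \<Rightarrow> nat \<Rightarrow> nat \<Rightarrow> bool" where
  "is_code_RL H n r d R l \<longleftrightarrow> parity_check H n r \<and> has_min_dist H n d \<and>
     has_covering_radius H n r R \<and> (\<exists>P. RL_partition H n r R l P)"

definition ell2 :: "nat \<Rightarrow> nat \<Rightarrow> nat" where
  "ell2 r R = (LEAST n. \<exists>H. parity_check H n r \<and> has_covering_radius H n r R)"

end

theory Submission
  imports Defs "HOL-Library.Z2" "HOL-Library.Product_Plus" "HOL-Library.Function_Algebras"
    "HOL-Algebra.Algebraic_Closure_Type" "HOL-Real_Asymp.Real_Asymp"
begin

text \<open>Coverings are lifted along the twisted cubic: attach to the part with label \<open>u\<close> of a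
  partition of the columns a point of the twisted cubic over \<open>F_q\<close>, and replace every column \<open>c\<close>
  of that part by the \<open>q\<close> columns \<open>(c, x p_u)\<close>.  Any four points of the cubic are linearly
  independent, so a sum of four columns from different parts reaches every vector above it.  A sum of
  fewer columns is completed by multiples of points of the cubic that are attached to the zero column;
  this costs \<open>q - 1\<close> new columns per point.

  Starting from the repetition code of length 9 (codimension 8, radius 4), \<open>q = 8\<close> and all nine
  points of the cubic, 18 additional columns give 90 columns in codimension 20, every vector being a
  sum of 2, 3 or 4 columns from different parts.  Lifting with \<open>q = 32\<close> and two points on the zero
  column gives \<open>32 * 90 + 2 * 31 = 2942\<close> columns in codimension 40.  There every vector is a sum of 3
  or 4 columns from different parts, since a single column \<open>(c, x p_u)\<close> may be replaced by three
  columns \<open>(c, x_i p_u)\<close> with \<open>x = x_1 + x_2 + x_3\<close>.  The partition has at most 98 parts, so a last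
  lifting with \<open>q = 2 ^ (t - 10) \<ge> 128\<close> and one point on the zero column gives
  \<open>2942 q + q - 1\<close> columns in codimension \<open>4 t\<close>.\<close>

subsection \<open>Finite fields of characteristic two\<close>

text \<open>All finite fields are realised inside one algebraic closure of F_2, so that those of
  order 8, 32 and 2^m share a type.\<close>

type_synonym gf = "bit alg_closure"

lemma CHAR_bit: "CHAR(bit) = 2"
proof (rule CHAR_eqI)
  show "of_nat 2 = (0::bit)" by simp
next
  fix n :: nat assume "of_nat n = (0::bit)"
  then show "2 dvd n" by (cases "even n") (auto elim: oddE)
qed

lemma CHAR_gf: "CHAR(gf) = 2"
  by (simp add: CHAR_bit)

lemma gf_uminus [simp]: "- x = (x::gf)"
  by (rule uminus_CHAR_2[OF CHAR_gf])

lemma gf_minus [simp]: "x - y = (x + y :: gf)"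
  by (rule minus_CHAR_2[OF CHAR_gf])

lemma gf_add_self [simp]: "x + x = (0::gf)"
  using gf_minus[of x x] by simp

lemma gf_add_self_left [simp]: "x + (x + y) = (y::gf)"
  by (metis add.assoc add_0 gf_add_self)

lemma gf_add_eq_0 [simp]: "x + y = 0 \<longleftrightarrow> x = (y::gf)"
  by (metis add.right_neutral gf_add_self_left gf_add_self)

lemma gf_two [simp]: "(2::gf) = 0"
  by (metis gf_add_self one_add_one)

text \<open>The fixed points of the m-th iterate of Frobenius: the field of order 2^m if m > 0, but
  the whole closure if m = 0.\<close>

definition GF :: "nat \<Rightarrow> gf set" where
  "GF m = {x. x ^ 2 ^ m = x}"

definition gf_subfield :: "gf set \<Rightarrow> bool" where
  "gf_subfield K \<longleftrightarrow> finite K \<and> 0 \<in> K \<and> 1 \<in> K \<and>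
     (\<forall>x\<in>K. \<forall>y\<in>K. x + y \<in> K \<and> x * y \<in> K) \<and> (\<forall>x\<in>K. inverse x \<in> K)"

lemma subfieldD:
  assumes "gf_subfield K"
  shows subfield_finite: "finite K" and subfield_0: "0 \<in> K" and subfield_1: "1 \<in> K"
    and subfield_add: "\<And>x y. x \<in> K \<Longrightarrow> y \<in> K \<Longrightarrow> x + y \<in> K"
    and subfield_mult: "\<And>x y. x \<in> K \<Longrightarrow> y \<in> K \<Longrightarrow> x * y \<in> K"
    and subfield_inverse: "\<And>x. x \<in> K \<Longrightarrow> inverse x \<in> K"
    and subfield_divide: "\<And>x y. x \<in> K \<Longrightarrow> y \<in> K \<Longrightarrow> x / y \<in> K"
    and subfield_power: "\<And>x n. x \<in> K \<Longrightarrow> x ^ n \<in> K"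
proof -
  show *: "finite K" "0 \<in> K" "1 \<in> K" "\<And>x y. x \<in> K \<Longrightarrow> y \<in> K \<Longrightarrow> x + y \<in> K"
    "\<And>x y. x \<in> K \<Longrightarrow> y \<in> K \<Longrightarrow> x * y \<in> K" "\<And>x. x \<in> K \<Longrightarrow> inverse x \<in> K"
    using assms unfolding gf_subfield_def by auto
  show "\<And>x y. x \<in> K \<Longrightarrow> y \<in> K \<Longrightarrow> x / y \<in> K"
    by (simp add: * divide_inverse)
  show "x ^ n \<in> K" if "x \<in> K" for x n
    by (induction n) (simp_all add: * that)
qed

lemmas subfield_intros =
  subfield_0 subfield_1 subfield_add subfield_mult subfield_inverse subfield_divide subfield_power

lemma subfield_sum: "gf_subfield K \<Longrightarrow> (\<And>a. a \<in> A \<Longrightarrow> g a \<in> K) \<Longrightarrow> sum g A \<in> K"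
  by (induction A rule: infinite_finite_induct) (auto intro: subfield_intros)

text \<open>X^q + X splits over the closure, and its derivative is 1, so its q roots are
  distinct.\<close>

lemma card_GF:
  assumes "m > 0"
  shows "card (GF m) = 2 ^ m"
proof -
  define q where "q = (2::nat) ^ m"
  have q: "q > 1" and "even q"
    using assms one_less_power[of "2::nat" m] by (simp_all add: q_def)
  define p :: "gf poly" where "p = monom 1 q + [:0, 1:]"
  have poly_p: "poly p x = x ^ q + x" for x
    by (simp add: p_def poly_monom)
  have deg: "degree p = q"
    unfolding p_def using q by (subst degree_add_eq_left) (auto simp: degree_monom_eq)
  then have "p \<noteq> 0" using q by auto
  have "pderiv p = 1"
  proof -
    have "(of_nat q :: gf) = 0"
      using \<open>even q\<close> CHAR_gf by (simp add: of_nat_eq_0_iff_char_dvd)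
    then show ?thesis by (simp add: p_def pderiv_add pderiv_monom pderiv_pCons one_pCons)
  qed
  have order_le: "order a p \<le> 1" for a
  proof (rule ccontr)
    assume "\<not> order a p \<le> 1"
    then have "[:-a, 1:] ^ 2 dvd p"
      by (subst order_divides) auto
    then obtain r where "p = [:-a, 1:] ^ 2 * r" by (elim dvdE)
    then have "p = [:-a, 1:] * ([:-a, 1:] * r)"
      by (simp only: power2_eq_square mult.assoc)
    then have "poly (pderiv p) a = 0"
      by (simp only: pderiv_mult poly_add poly_mult) simp
    then show False using \<open>pderiv p = 1\<close> by simp
  qed
  obtain A where A: "size A = degree p" "p = smult (lead_coeff p) (\<Prod>x\<in>#A. [:-x, 1:])"
    using alg_closed_imp_factorization[OF \<open>p \<noteq> 0\<close>] by blast
  have "proots p = A"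
  proof -
    have "proots (\<Prod>x\<in>#A. [:-x, 1:]) = A"
    proof (induction A)
      case (add x A)
      have "proots (\<Prod>x\<in>#add_mset x A. [:-x, 1:]) = proots ([:-x, 1:] * (\<Prod>x\<in>#A. [:-x, 1:]))"
        by (simp only: image_mset_add_mset prod_mset.add_mset)
      also have "\<dots> = {#x#} + A"
        by (subst proots_mult) (simp_all only: add.IH proots_linear_factor, auto simp: prod_mset_zero_iff)
      finally show ?case by simp
    qed simp
    then show ?thesis
      by (subst A(2)) (use \<open>p \<noteq> 0\<close> in \<open>simp add: proots_smult del: gf_uminus\<close>)
  qed
  have "proots p = mset_set {x. poly p x = 0}"
  proof (rule multiset_eqI)
    fix x
    have "finite {x. poly p x = 0}" using \<open>p \<noteq> 0\<close> by (rule poly_roots_finite)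
    moreover have "order x p = (if poly p x = 0 then 1 else 0)"
      using order_le[of x] \<open>p \<noteq> 0\<close> by (auto simp: order_root order_0I)
    ultimately show "count (proots p) x = count (mset_set {x. poly p x = 0}) x"
      using \<open>p \<noteq> 0\<close> by (simp add: count_mset_set')
  qed
  then have "card {x. poly p x = 0} = q"
    using A(1) deg \<open>proots p = A\<close> by (metis size_mset_set)
  moreover have "{x. poly p x = 0} = GF m"
    by (simp add: poly_p GF_def q_def)
  ultimately show ?thesis by (simp add: q_def)
qed

lemma subfield_GF:
  assumes "m > 0"
  shows "gf_subfield (GF m)"
proof -
  have "prime CHAR(gf)" by (simp only: CHAR_gf two_is_prime_nat)
  then have "(x + y) ^ 2 ^ m = x ^ 2 ^ m + y ^ 2 ^ m" for x y :: gf
    by (rule freshmans_dream') (simp only: CHAR_gf)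
  moreover have "finite (GF m)"
    using card_GF[OF assms] by (metis card.infinite power_not_zero zero_neq_numeral)
  ultimately show ?thesis
    by (auto simp: gf_subfield_def GF_def power_mult_distrib power_inverse)
qed

subsection \<open>The twisted cubic\<close>

text \<open>Induction on the nodes. In characteristic 2 the combination y (k + 1) + d y k removes
  the node d and multiplies the weight of b by b + d; the weights solving this smaller system are
  divided by b + d.\<close>

lemma vandermonde_solve:
  assumes K: "gf_subfield K" and "finite B" "B \<subseteq> K" "\<And>k. y k \<in> K"
  shows "\<exists>\<xi>. (\<forall>b. \<xi> b \<in> K) \<and> (\<forall>k<card B. (\<Sum>b\<in>B. \<xi> b * b ^ k) = y k)"
  using assms(2-)
proof (induction B arbitrary: y rule: finite_induct)
  case empty
  then show ?case using K by (auto intro: exI[of _ "\<lambda>_. 0"] subfield_0)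
next
  case (insert d B)
  from insert.IH[of "\<lambda>k. y (Suc k) + d * y k"] insert.prems
  obtain \<eta> where \<eta>: "\<And>b. \<eta> b \<in> K"
    "\<And>k. k < card B \<Longrightarrow> (\<Sum>b\<in>B. \<eta> b * b ^ k) = y (Suc k) + d * y k"
    using K by (auto intro!: subfield_add[OF K] subfield_mult[OF K])
  \<comment> \<open>The weight of \<open>d\<close> makes equation 0 hold. Each later equation
    follows from the one before it, because the combination of the two holds by the choice of
    \<open>\<eta>\<close>.\<close>
  define \<xi> where "\<xi> = (\<lambda>b. if b \<in> B then \<eta> b / (b + d) else if b = d then y 0 + (\<Sum>b\<in>B. \<eta> b / (b + d)) else 0)"
  have dB: "d \<in> K" "B \<subseteq> K" using insert.prems by auto
  have "\<xi> b \<in> K" for b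
    unfolding \<xi>_def using dB \<eta>(1) insert.prems
    by (auto intro!: subfield_intros[OF K] subfield_sum[OF K])
  moreover have "(\<Sum>b\<in>insert d B. \<xi> b * b ^ k) = y k" if "k < card (insert d B)" for k
    using that
  proof (induction k)
    case 0
    have "(\<Sum>b\<in>B. \<xi> b) = (\<Sum>b\<in>B. \<eta> b / (b + d))" by (simp add: \<xi>_def)
    then show ?case using insert.hyps by (simp add: \<xi>_def)
  next
    case (Suc k)
    then have k: "k < card B" using insert.hyps by simp
    have "(\<Sum>b\<in>insert d B. \<xi> b * b ^ Suc k) + d * (\<Sum>b\<in>insert d B. \<xi> b * b ^ k)
        = (\<Sum>b\<in>insert d B. \<xi> b * b ^ Suc k + d * (\<xi> b * b ^ k))"
      by (simp add: sum_distrib_left sum.distrib)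
    also have "\<dots> = (\<Sum>b\<in>insert d B. \<xi> b * (b + d) * b ^ k)"
      by (intro sum.cong) (auto simp: algebra_simps)
    also have "\<dots> = (\<Sum>b\<in>B. \<xi> b * (b + d) * b ^ k)" using insert.hyps by simp
    also have "\<dots> = (\<Sum>b\<in>B. \<eta> b * b ^ k)"
      using insert.hyps by (intro sum.cong) (auto simp: \<xi>_def)
    also have "\<dots> = y (Suc k) + d * y k" by (rule \<eta>(2)[OF k])
    finally have "(\<Sum>b\<in>insert d B. \<xi> b * b ^ Suc k) + d * y k = y (Suc k) + d * y k"
      using Suc by simp
    then show ?case by (metis add_right_cancel)
  qed
  ultimately show ?case by blast
qed

text \<open>\<open>pt u x\<close> is the multiple by \<open>x\<close> of the point of the twisted cubic with parameter \<open>u\<close>,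
  where \<open>None\<close> stands for the point at infinity.\<close>

type_synonym gf4 = "gf \<times> gf \<times> gf \<times> gf"

fun pt :: "gf option \<Rightarrow> gf \<Rightarrow> gf4" where
  "pt (Some b) x = (x, x * b, x * b ^ 2, x * b ^ 3)"
| "pt None x = (0, 0, 0, x)"

definition pow4 :: "gf set \<Rightarrow> gf4 set" where
  "pow4 K = K \<times> K \<times> K \<times> K"

lemma pt_0 [simp]: "pt u 0 = 0"
  by (cases u) (simp_all add: zero_prod_def)

lemma pt_add: "pt u (x + y) = pt u x + pt u y"
  by (cases u) (simp_all add: algebra_simps)

lemma pt_inject: "pt u x = pt u y \<Longrightarrow> x = y"
  by (cases u) auto

lemma pt_eqD:
  assumes "pt u x = pt v y" "x \<noteq> 0"
  shows "u = v" "x = y"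
  using assms by (cases u; cases v; auto)+

lemma pt_eq_0_iff [simp]: "pt u x = 0 \<longleftrightarrow> x = 0"
  using pt_inject[of u x 0] by auto

lemma pt_in_pow4: "gf_subfield K \<Longrightarrow> u \<in> insert None (Some ` K) \<Longrightarrow> x \<in> K \<Longrightarrow> pt u x \<in> pow4 K"
  by (cases u) (auto simp: pow4_def subfield_0 subfield_mult subfield_power)

text \<open>Four points of the cubic form a basis. For finite points this is Vandermonde; if
  \<open>None\<close> is among them, the other three settle the first three coordinates and
  \<open>None\<close> the last one.\<close>

lemma arc_solve:
  assumes K: "gf_subfield K" and T: "T \<subseteq> insert None (Some ` K)" "card T = 4" and y: "y \<in> pow4 K"
  shows "\<exists>\<xi>. (\<forall>u. \<xi> u \<in> K) \<and> (\<Sum>u\<in>T. pt u (\<xi> u)) = y"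
proof -
  obtain y0 y1 y2 y3 where y_eq: "y = (y0, y1, y2, y3)" by (metis prod_cases4)
  \<comment> \<open>Reduction modulo 4 keeps every value of the sequence in \<open>K\<close>, as
    \<open>vandermonde_solve\<close> demands for all indices.\<close>
  define z where "z = (\<lambda>k::nat. [y0, y1, y2, y3] ! (k mod 4))"
  have z: "z k \<in> K" for k
  proof -
    have "k mod 4 \<in> {0, 1, 2, 3}" by auto
    then show ?thesis using y by (auto simp: z_def y_eq pow4_def)
  qed
  define B where "B = {b. Some b \<in> T}"
  have finT: "finite T" using T(2) by (metis card.infinite zero_neq_numeral)
  have B: "B \<subseteq> K" using T(1) by (auto simp: B_def)
  then have finB: "finite B" using subfield_finite[OF K] by (rule finite_subset)
  obtain \<xi> where "(\<forall>b. \<xi> b \<in> K) \<and> (\<forall>k<card B. (\<Sum>b\<in>B. \<xi> b * b ^ k) = z k)"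
    using vandermonde_solve[OF K finB B, of z] z by metis
  then have \<xi>: "\<And>b. \<xi> b \<in> K" "\<And>k. k < card B \<Longrightarrow> (\<Sum>b\<in>B. \<xi> b * b ^ k) = z k"
    by auto
  have sumB: "(\<Sum>b\<in>B. pt (Some b) (\<xi> b))
      = (\<Sum>b\<in>B. \<xi> b * b ^ 0, \<Sum>b\<in>B. \<xi> b * b ^ 1, \<Sum>b\<in>B. \<xi> b * b ^ 2, \<Sum>b\<in>B. \<xi> b * b ^ 3)"
    by (simp add: sum_prod)
  \<comment> \<open>The coefficient at infinity is what the finite points leave over in the last
    coordinate.\<close>
  define \<eta> where "\<eta> = case_option (y3 + (\<Sum>b\<in>B. \<xi> b * b ^ 3)) \<xi>"
  have "y3 \<in> K" using y by (auto simp: y_eq pow4_def)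
  then have \<eta>: "\<eta> u \<in> K" for u
    using \<xi>(1) B by (cases u) (auto simp: \<eta>_def intro!: subfield_add[OF K] subfield_sum[OF K] subfield_mult[OF K] subfield_power[OF K])
  have sumS: "(\<Sum>u\<in>Some ` B. pt u (\<eta> u)) = (\<Sum>b\<in>B. pt (Some b) (\<xi> b))"
    by (subst sum.reindex) (auto simp: \<eta>_def)
  have "(\<Sum>u\<in>T. pt u (\<eta> u)) = y"
  proof (cases "None \<in> T")
    case True
    have T_eq: "T = insert None (Some ` B)"
    proof (rule Set.set_eqI)
      fix u show "u \<in> T \<longleftrightarrow> u \<in> insert None (Some ` B)"
        using True by (cases u) (auto simp: B_def)
    qed
    then have "card B = 3" using T(2) finB by (simp add: card_image)
    then have "(\<Sum>b\<in>B. \<xi> b * b ^ 0) = y0" "(\<Sum>b\<in>B. \<xi> b * b ^ 1) = y1" "(\<Sum>b\<in>B. \<xi> b * b ^ 2) = y2"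
      using \<xi>(2)[of 0] \<xi>(2)[of 1] \<xi>(2)[of 2] by (simp_all add: z_def)
    moreover have "(\<Sum>u\<in>T. pt u (\<eta> u)) = pt None (\<eta> None) + (\<Sum>u\<in>Some ` B. pt u (\<eta> u))"
      unfolding T_eq using finB by (subst sum.insert) auto
    ultimately have "(\<Sum>u\<in>T. pt u (\<eta> u))
        = pt None (\<eta> None) + (y0, y1, y2, \<Sum>b\<in>B. \<xi> b * b ^ 3)"
      by (simp only: sumS sumB)
    then show ?thesis by (simp add: \<eta>_def y_eq add.assoc)
  next
    case False
    have T_eq: "T = Some ` B"
    proof (rule Set.set_eqI)
      fix u show "u \<in> T \<longleftrightarrow> u \<in> Some ` B"
        using False by (cases u) (auto simp: B_def)
    qed
    then have "card B = 4" using T(2) finB by (simp add: card_image)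
    then have "(\<Sum>b\<in>B. \<xi> b * b ^ 0) = y0" "(\<Sum>b\<in>B. \<xi> b * b ^ 1) = y1" "(\<Sum>b\<in>B. \<xi> b * b ^ 2) = y2"
      "(\<Sum>b\<in>B. \<xi> b * b ^ 3) = y3"
      using \<xi>(2)[of 0] \<xi>(2)[of 1] \<xi>(2)[of 2] \<xi>(2)[of 3] by (simp_all add: z_def)
    then show ?thesis by (simp only: T_eq sumS sumB y_eq)
  qed
  then show ?thesis using \<eta> by blast
qed

subsection \<open>Lifting a covering along the twisted cubic\<close>

text \<open>The columns are the elements of \<open>C\<close>; a choice of columns with pairwise different labels
  is one that uses every part of the partition at most once.\<close>

definition labelled_cover :: "'a::ab_group_add set \<Rightarrow> 'a set \<Rightarrow> ('a \<Rightarrow> 'l) \<Rightarrow> nat \<Rightarrow> bool" where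
  "labelled_cover V C lam l \<longleftrightarrow> finite C \<and> 0 \<notin> C \<and> C \<subseteq> V \<and>
     (\<forall>v\<in>V. \<exists>S\<subseteq>C. l \<le> card S \<and> card S \<le> 4 \<and> inj_on lam S \<and> \<Sum>S = v)"

text \<open>\<open>U\<close> holds the points attached to the zero column; the multiple 0 is left
  out there because it is the zero vector.\<close>

definition lift :: "gf set \<Rightarrow> gf option set \<Rightarrow> ('a::ab_group_add \<Rightarrow> gf option) \<Rightarrow> 'a set \<Rightarrow> ('a \<times> gf4) set" where
  "lift K U p C = (\<lambda>(c, x). (c, pt (p c) x)) ` (C \<times> K) \<union> (\<lambda>(u, x). (0, pt u x)) ` (U \<times> (K - {0}))"

lemma sum_pair: "(\<Sum>a\<in>A. (g a, h a)) = (sum g A, sum h A)"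
  by (induction A rule: infinite_finite_induct) (simp_all add: zero_prod_def)

text \<open>The labels of \<open>S\<close> and the points of \<open>W\<close> are four points in
  all, so \<open>arc_solve\<close> gives coefficients for every \<open>y\<close>. A column over
  \<open>S\<close> is kept even if its coefficient is 0, while a point of \<open>W\<close> with
  coefficient 0 contributes no column; hence the exact count.\<close>

lemma lift_solve:
  assumes K: "gf_subfield K" and S: "finite S" "S \<subseteq> C" "inj_on p S" "0 \<notin> C" "p ` S \<inter> W = {}"
    and W: "finite W" "W \<subseteq> U"
    and pts: "p ` S \<union> W \<subseteq> insert None (Some ` K)" and card: "card S + card W = 4"
    and y: "y \<in> pow4 K"
  obtains \<xi> S' where "\<And>u. \<xi> u \<in> K"
    "S' = (\<lambda>c. (c, pt (p c) (\<xi> (p c)))) ` S \<union> (\<lambda>u. (0, pt u (\<xi> u))) ` {u \<in> W. \<xi> u \<noteq> 0}"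
    "S' \<subseteq> lift K U p C" "\<Sum>S' = (\<Sum>S, y)" "card S' = card S + card {u \<in> W. \<xi> u \<noteq> 0}"
proof -
  have "card (p ` S \<union> W) = 4"
    using S W card by (simp add: card_Un_disjoint card_image)
  then obtain \<xi> where \<xi>: "\<And>u. \<xi> u \<in> K" "(\<Sum>u\<in>p ` S \<union> W. pt u (\<xi> u)) = y"
    using arc_solve[OF K pts _ y] by blast
  define W' where "W' = {u \<in> W. \<xi> u \<noteq> 0}"
  have W': "finite W'" "W' \<subseteq> W" using W by (auto simp: W'_def)
  define A1 where "A1 = (\<lambda>c. (c, pt (p c) (\<xi> (p c)))) ` S"
  define A2 where "A2 = (\<lambda>u. (0::'a, pt u (\<xi> u))) ` W'"
  have inj2: "inj_on (\<lambda>u. (0::'a, pt u (\<xi> u))) W'"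
    by (rule inj_onI) (auto simp: W'_def dest: pt_eqD)
  have disj: "A1 \<inter> A2 = {}" using S by (auto simp: A1_def A2_def)
  have fin: "finite A1" "finite A2" using S W' by (auto simp: A1_def A2_def)
  have "\<Sum>A1 = (\<Sum>c\<in>S. (c, pt (p c) (\<xi> (p c))))"
    unfolding A1_def by (subst sum.reindex) (auto intro: inj_onI)
  also have "\<dots> = (\<Sum>S, \<Sum>u\<in>p ` S. pt u (\<xi> u))"
    using S by (simp add: sum_pair sum.reindex)
  finally have s1: "\<Sum>A1 = (\<Sum>S, \<Sum>u\<in>p ` S. pt u (\<xi> u))" .
  have "\<Sum>A2 = (\<Sum>u\<in>W'. (0, pt u (\<xi> u)))"
    unfolding A2_def using inj2 by (subst sum.reindex) auto
  also have "\<dots> = (0, \<Sum>u\<in>W. pt u (\<xi> u))"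
    using W by (auto simp: sum_pair W'_def intro!: sum.mono_neutral_left)
  finally have s2: "\<Sum>A2 = (0, \<Sum>u\<in>W. pt u (\<xi> u))" .
  have "\<Sum>(A1 \<union> A2) = (\<Sum>S, \<Sum>u\<in>p ` S \<union> W. pt u (\<xi> u))"
    using fin disj S W by (simp add: sum.union_disjoint s1 s2)
  moreover have "card (A1 \<union> A2) = card S + card W'"
    using fin disj inj2 by (simp add: card_Un_disjoint) (simp add: A1_def A2_def card_image inj_on_def)
  moreover have "A1 \<subseteq> (\<lambda>(c, x). (c, pt (p c) x)) ` (C \<times> K)"
    unfolding A1_def using S(2) \<xi>(1) by force
  then have "A1 \<union> A2 \<subseteq> lift K U p C"
    unfolding A2_def W'_def lift_def using W(2) \<xi>(1) by force
  ultimately show thesis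
    using that[of \<xi> "A1 \<union> A2"] \<xi> by (simp add: A1_def A2_def W'_def)
qed


lemma finite_lift:
  assumes "finite K" "finite U" "finite C"
  shows "finite (lift K U p C)"
  using assms by (simp add: lift_def)

lemma card_lift:
  assumes "finite K" "finite U" "finite C" "0 \<notin> C" "0 \<in> K"
  shows "card (lift K U p C) = card C * card K + card U * (card K - 1)"
proof -
  have "inj_on (\<lambda>(c, x). (c, pt (p c) x)) (C \<times> K)"
    by (auto intro!: inj_onI dest: pt_inject)
  moreover have "inj_on (\<lambda>(u, x). (0::'a, pt u x)) (U \<times> (K - {0}))"
    by (auto intro!: inj_onI dest: pt_eqD)
  moreover have "(\<lambda>(c, x). (c, pt (p c) x)) ` (C \<times> K) \<inter> (\<lambda>(u, x). (0, pt u x)) ` (U \<times> (K - {0})) = {}"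
    using assms(4) by auto
  ultimately show ?thesis
    unfolding lift_def using assms
    by (subst card_Un_disjoint) (simp_all add: card_image card_cartesian_product)
qed

lemma lift_wf:
  assumes K: "gf_subfield K" and cov: "labelled_cover V C p l" and V: "0 \<in> V"
    and p: "p ` C \<subseteq> insert None (Some ` K)" and U: "finite U" "U \<subseteq> insert None (Some ` K)"
  shows "finite (lift K U p C)" "0 \<notin> lift K U p C" "lift K U p C \<subseteq> V \<times> pow4 K"
proof -
  have C: "finite C" "0 \<notin> C" "C \<subseteq> V" using cov by (auto simp: labelled_cover_def)
  show "finite (lift K U p C)" using finite_lift C U subfield_finite[OF K] by blast
  show "0 \<notin> lift K U p C"
  proof
    assume "0 \<in> lift K U p C"
    moreover have "snd z \<noteq> 0" if "z \<in> lift K U p C" "fst z = 0" for z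
      using that C(2) by (auto simp: lift_def)
    ultimately show False using fst_zero snd_zero by blast
  qed
  have "pt u x \<in> pow4 K" if "u \<in> p ` C \<union> U" "x \<in> K" for u x
    using pt_in_pow4[OF K _ that(2)] that(1) p U(2) by blast
  then show "lift K U p C \<subseteq> V \<times> pow4 K" using C V by (auto simp: lift_def)
qed

text \<open>Only the fibres of the labelling matter, so the labels may be renamed to points of the
  cubic, as \<open>lift\<close> needs them, whenever there are enough points.\<close>

lemma labelled_cover_relabel:
  assumes cov: "labelled_cover V C lam l" and "finite B" "card (lam ` C) \<le> card B"
  obtains g where "g ` lam ` C \<subseteq> B" "labelled_cover V C (\<lambda>c. g (lam c)) l"
    "card ((\<lambda>c. g (lam c)) ` C) = card (lam ` C)"
proof -
  have fin: "finite C" using cov by (simp add: labelled_cover_def)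
  obtain g where g: "g ` lam ` C \<subseteq> B" "inj_on g (lam ` C)"
    using card_le_inj[of "lam ` C" B] fin assms(2,3) by auto
  have "inj_on (\<lambda>c. g (lam c)) S" if "S \<subseteq> C" "inj_on lam S" for S
    using comp_inj_on[OF that(2), of g] inj_on_subset[OF g(2)] that(1) by (auto simp: comp_def image_mono)
  then have "labelled_cover V C (\<lambda>c. g (lam c)) l"
    using cov unfolding labelled_cover_def by meson
  moreover have "(\<lambda>c. g (lam c)) ` C = g ` lam ` C" by auto
  then have "card ((\<lambda>c. g (lam c)) ` C) = card (lam ` C)"
    using g(2) by (simp add: card_image)
  ultimately show thesis using that g(1) by blast
qed

text \<open>Infinity is not the label of any column, hence it is free to complete a sum of three.
  Afterwards every column is a part of its own.\<close>

lemma lift_cover_3: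
  assumes K: "gf_subfield K" and cov: "labelled_cover V C p 3" and V: "0 \<in> V"
    and p: "p ` C \<subseteq> Some ` K"
  shows "labelled_cover (V \<times> pow4 K) (lift K {None} p C) (\<lambda>c. c) 3"
proof -
  have "\<exists>S'\<subseteq>lift K {None} p C. 3 \<le> card S' \<and> card S' \<le> 4 \<and> \<Sum>S' = (v, y)"
    if v: "v \<in> V" and y: "y \<in> pow4 K" for v y
  proof -
    obtain S where S: "S \<subseteq> C" "3 \<le> card S" "card S \<le> 4" "inj_on p S" "\<Sum>S = v"
      using cov v by (auto simp: labelled_cover_def)
    define W where "W = (if card S = 3 then {None} else {} :: gf option set)"
    have W: "finite W" "W \<subseteq> {None}" "card S + card W = 4" using S by (auto simp: W_def)
    have fin: "finite S" and C0: "0 \<notin> C"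
      using cov finite_subset[OF S(1)] by (auto simp: labelled_cover_def)
    have pS: "p ` S \<subseteq> Some ` K" "W \<inter> Some ` K = {}"
      using p S(1) W(2) by auto
    then have disj: "p ` S \<inter> W = {}" by blast
    have pts: "p ` S \<union> W \<subseteq> insert None (Some ` K)"
      using pS(1) W(2) by auto
    obtain \<xi> S' where "\<And>u. \<xi> u \<in> K"
      and "S' = (\<lambda>c. (c, pt (p c) (\<xi> (p c)))) ` S \<union> (\<lambda>u. (0, pt u (\<xi> u))) ` {u \<in> W. \<xi> u \<noteq> 0}"
      and "S' \<subseteq> lift K {None} p C" "\<Sum>S' = (\<Sum>S, y)"
        "card S' = card S + card {u \<in> W. \<xi> u \<noteq> 0}"
      using lift_solve[OF K fin S(1,4) C0 disj W(1,2) pts W(3) y] by blast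
    moreover have "card {u \<in> W. \<xi> u \<noteq> 0} \<le> card W" using W(1) by (auto intro: card_mono)
    ultimately show ?thesis using S(2,5) W(3) by (intro exI[of _ S']) auto
  qed
  moreover have "p ` C \<subseteq> insert None (Some ` K)" using p by blast
  ultimately show ?thesis
    using lift_wf[OF K cov V] by (auto simp: labelled_cover_def)
qed

text \<open>For d outside {0, 1} this divides a field into {0}, {1}, {d} and the rest, which carries
  the label 1 + d, one of its own elements.\<close>

definition part4 :: "gf \<Rightarrow> gf \<Rightarrow> gf" where
  "part4 d x = (if x \<in> {0, 1, d} then x else 1 + d)"

text \<open>The sums are 0 = 1 + d + (1 + d), 1 = 0 + d + (1 + d), and otherwise x = 0 + 1 + (1 +
  x), where 1 + x differs from 0 and 1.\<close>

lemma sum_from_three_parts: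
  assumes K: "gf_subfield K" and d: "d \<in> K" "d \<noteq> 0" "d \<noteq> 1" and x: "x \<in> K"
  obtains a b e where "a \<in> K" "b \<in> K" "e \<in> K" "x = a + b + e"
    "part4 d a \<noteq> part4 d b" "part4 d a \<noteq> part4 d e" "part4 d b \<noteq> part4 d e"
proof -
  have d': "1 + d \<noteq> 0" "1 + d \<noteq> 1" "1 + d \<noteq> d" using d by auto
  have cls: "1 \<in> K" "0 \<in> K" "1 + d \<in> K" "1 + x \<in> K"
    using K d x by (auto intro: subfield_intros)
  consider "x = 0" | "x = 1" | "x \<noteq> 0" "x \<noteq> 1" by blast
  then show thesis
  proof cases
    case 1
    show ?thesis
      by (rule that[of 1 d "1 + d"]) (use 1 d d' cls in \<open>auto simp: part4_def add.assoc\<close>)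
  next
    case 2
    show ?thesis
      by (rule that[of 0 d "1 + d"]) (use 2 d d' cls in \<open>auto simp: part4_def add.left_commute\<close>)
  next
    case 3
    then have "1 + x \<noteq> 0" "1 + x \<noteq> 1" by auto
    then show ?thesis
      by (intro that[of 0 1 "1 + x"]) (use 3 d d' cls in \<open>auto simp: part4_def\<close>)
  qed
qed


text \<open>The columns over c are split by the class of the multiplier, which is their first
  coordinate when \<open>p c\<close> is finite. Over the zero column, first coordinate 0 marks the
  multiples of infinity and any other value those of the point \<open>Some 0\<close>.\<close>

definition label4 :: "gf \<Rightarrow> ('a::zero \<Rightarrow> gf option) \<Rightarrow> 'a \<times> gf4 \<Rightarrow> gf option \<times> gf" where
  "label4 d p = (\<lambda>(c, y). if c = 0 then (if fst y = 0 then None else Some 0, 0) else (p c, part4 d (fst y)))"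

text \<open>A sum of two columns is completed by the two points reserved for the zero column. If
  both coefficients vanish, only two columns remain; then one of them is replaced by three columns
  over the same c, since c + c + c = c. Splitting each part into four keeps these three
  apart.\<close>

lemma lift_cover_2:
  assumes K: "gf_subfield K" and cov: "labelled_cover V C p 2" and V: "0 \<in> V"
    and V2: "\<And>v. v \<in> V \<Longrightarrow> v + v = 0"
    and p: "p ` C \<subseteq> Some ` (K - {0})" and d: "d \<in> K" "d \<noteq> 0" "d \<noteq> 1"
  shows "labelled_cover (V \<times> pow4 K) (lift K {None, Some 0} p C) (label4 d p) 3"
    "card (label4 d p ` lift K {None, Some 0} p C) \<le> 4 * card (p ` C) + 2"
proof -
  have C: "finite C" "0 \<notin> C" "C \<subseteq> V" using cov by (auto simp: labelled_cover_def)
  have p_Some: "\<exists>b\<in>K - {0}. p c = Some b" if "c \<in> C" for c using p that by auto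
  have label_c: "label4 d p (c, pt (p c) x) = (p c, part4 d x)" if "c \<in> C" for c x
    using p_Some[OF that] that C(2) by (auto simp: label4_def)
  have label_0: "label4 d p (0, pt u x) = (u, 0)" if "u \<in> {None, Some 0}" "x \<noteq> 0" for u x
    using that by (auto simp: label4_def)
  have "\<exists>S'\<subseteq>lift K {None, Some 0} p C. 3 \<le> card S' \<and> card S' \<le> 4 \<and> inj_on (label4 d p) S' \<and> \<Sum>S' = (v, y)"
    if v: "v \<in> V" and y: "y \<in> pow4 K" for v y
  proof -
    obtain S where S: "S \<subseteq> C" "2 \<le> card S" "card S \<le> 4" "inj_on p S" "\<Sum>S = v"
      using cov v by (auto simp: labelled_cover_def)
    define W where "W = (if card S = 4 then {} else if card S = 3 then {None} else {None, Some 0 :: gf option})"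
    have W: "finite W" "W \<subseteq> {None, Some 0}" "card S + card W = 4" using S by (auto simp: W_def)
    have fin: "finite S" using C finite_subset[OF S(1)] by auto
    have pS: "p ` S \<subseteq> Some ` (K - {0})" "W \<inter> Some ` (K - {0}) = {}"
      using p S(1) W(2) by auto
    then have disj: "p ` S \<inter> W = {}" by blast
    have pts: "p ` S \<union> W \<subseteq> insert None (Some ` K)"
      using pS(1) W(2) subfield_0[OF K] by auto
    obtain \<xi> S' where \<xi>: "\<And>u. \<xi> u \<in> K"
      and S'_eq: "S' = (\<lambda>c. (c, pt (p c) (\<xi> (p c)))) ` S \<union> (\<lambda>u. (0, pt u (\<xi> u))) ` {u \<in> W. \<xi> u \<noteq> 0}"
      and S': "S' \<subseteq> lift K {None, Some 0} p C" "\<Sum>S' = (\<Sum>S, y)"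
        "card S' = card S + card {u \<in> W. \<xi> u \<noteq> 0}"
      using lift_solve[OF K fin S(1,4) C(2) disj W(1,2) pts W(3) y] by blast
    show ?thesis
    proof (cases "3 \<le> card S'")
      case True
      have lab1: "fst (label4 d p (c, pt (p c) (\<xi> (p c)))) = p c" if "c \<in> S" for c
        using label_c[of c] S(1) that by auto
      have lab2: "fst (label4 d p (0, pt u (\<xi> u))) = u" if "u \<in> W" "\<xi> u \<noteq> 0" for u
        using label_0[of u] W(2) that by auto
      \<comment> \<open>The first components of the labels already separate these columns: they are
        the points of the cubic in use, each occurring once.\<close>
      have "inj_on (\<lambda>z. fst (label4 d p z)) S'"
        unfolding S'_eq
      proof (rule inj_onI)
        fix z z' assume z: "z \<in> (\<lambda>c. (c, pt (p c) (\<xi> (p c)))) ` S \<union> (\<lambda>u. (0, pt u (\<xi> u))) ` {u \<in> W. \<xi> u \<noteq> 0}"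
          and z': "z' \<in> (\<lambda>c. (c, pt (p c) (\<xi> (p c)))) ` S \<union> (\<lambda>u. (0, pt u (\<xi> u))) ` {u \<in> W. \<xi> u \<noteq> 0}"
          and eq: "fst (label4 d p z) = fst (label4 d p z')"
        show "z = z'"
          using z z' eq lab1 lab2 disj inj_onD[OF S(4)] by (elim UnE imageE) auto
      qed
      then have "inj_on (label4 d p) S'"
        by (auto simp: inj_on_def)
      moreover have "card {u \<in> W. \<xi> u \<noteq> 0} \<le> card W" using W(1) by (auto intro: card_mono)
      ultimately show ?thesis using True S' W(3) S(5) by (intro exI[of _ S']) auto
    next
      case False
      then have "card S = 2" "card {u \<in> W. \<xi> u \<noteq> 0} = 0" using S'(3) S(2) by auto
      then have zero: "{u \<in> W. \<xi> u \<noteq> 0} = {}" using W(1) by auto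
      obtain c1 c2 where S_eq: "S = {c1, c2}" "c1 \<noteq> c2"
        using \<open>card S = 2\<close> by (auto simp: card_2_iff)
      have c: "c1 \<in> C" "c2 \<in> C" "p c1 \<noteq> p c2" using S(1,4) S_eq by (auto simp: inj_on_def)
      have y_eq: "pt (p c1) (\<xi> (p c1)) + pt (p c2) (\<xi> (p c2)) = y" "v = c1 + c2"
        using S'(2) S(5) unfolding S'_eq zero S_eq(1) using S_eq(2) by auto
      obtain a b e where abe: "a \<in> K" "b \<in> K" "e \<in> K" "\<xi> (p c1) = a + b + e"
        "part4 d a \<noteq> part4 d b" "part4 d a \<noteq> part4 d e" "part4 d b \<noteq> part4 d e"
        using sum_from_three_parts[OF K d \<xi>] by blast
      define S2 where "S2 = {(c1, pt (p c1) a), (c1, pt (p c1) b), (c1, pt (p c1) e), (c2, pt (p c2) (\<xi> (p c2)))}"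
      have ne: "a \<noteq> b" "a \<noteq> e" "b \<noteq> e" using abe by auto
      then have ne': "pt (p c1) a \<noteq> pt (p c1) b" "pt (p c1) a \<noteq> pt (p c1) e" "pt (p c1) b \<noteq> pt (p c1) e"
        using pt_inject by blast+
      have "card S2 = 4" using ne' S_eq(2) by (simp add: S2_def)
      moreover have "\<Sum>S2 = (c1 + (c1 + (c1 + c2)), pt (p c1) (a + b + e) + pt (p c2) (\<xi> (p c2)))"
        using ne' S_eq(2) by (simp add: S2_def pt_add add.assoc)
      then have "\<Sum>S2 = (v, y)"
        using V2[of c1] C(3) c(1) y_eq abe(4) by (simp add: add.assoc[symmetric] subsetD)
      moreover have "S2 \<subseteq> lift K {None, Some 0} p C"
        using c abe(1-3) \<xi> unfolding S2_def lift_def by force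
      moreover have "inj_on (label4 d p) S2"
        using c abe(5-7) unfolding S2_def by (auto simp: inj_on_def label_c simp del: pt.simps)
      ultimately show ?thesis by (intro exI[of _ S2]) auto
    qed
  qed
  moreover have "p ` C \<subseteq> insert None (Some ` K)" "{None, Some 0} \<subseteq> insert None (Some ` K)"
    using p subfield_0[OF K] by auto
  ultimately show "labelled_cover (V \<times> pow4 K) (lift K {None, Some 0} p C) (label4 d p) 3"
    using lift_wf[OF K cov V] by (auto simp: labelled_cover_def)
  have "label4 d p ` lift K {None, Some 0} p C \<subseteq> p ` C \<times> {0, 1, d, 1 + d} \<union> {(None, 0), (Some 0, 0)}"
  proof (rule image_subsetI)
    fix z assume "z \<in> lift K {None, Some 0} p C"
    then have "(\<exists>c\<in>C. \<exists>x. z = (c, pt (p c) x)) \<or> (\<exists>u\<in>{None, Some 0}. \<exists>x. x \<noteq> 0 \<and> z = (0, pt u x))"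
      unfolding lift_def by (elim UnE imageE) (auto simp del: pt.simps)
    then consider c x where "c \<in> C" "z = (c, pt (p c) x)"
      | u x where "u \<in> {None, Some 0}" "x \<noteq> 0" "z = (0, pt u x)"
      by (elim disjE bexE exE conjE)
    then show "label4 d p z \<in> p ` C \<times> {0, 1, d, 1 + d} \<union> {(None, 0), (Some 0, 0)}"
      by cases (auto simp: label_c label_0 part4_def simp del: pt.simps)
  qed
  then have "card (label4 d p ` lift K {None, Some 0} p C)
      \<le> card (p ` C \<times> {0, 1, d, 1 + d} \<union> {(None, 0), (Some 0, 0)})"
    using C(1) by (intro card_mono) auto
  also have "\<dots> \<le> card (p ` C \<times> {0, 1, d, 1 + d}) + card {(None, 0), (Some 0 :: gf option, 0 :: gf)}"
    by (rule card_Un_le)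
  also have "\<dots> \<le> 4 * card (p ` C) + 2"
    using card_length[of "[0, 1, d, 1 + d]"] card_length[of "[(None, 0), (Some 0 :: gf option, 0 :: gf)]"]
    by (simp add: card_cartesian_product)
  finally show "card (label4 d p ` lift K {None, Some 0} p C) \<le> 4 * card (p ` C) + 2" .
qed

subsection \<open>The initial covering\<close>

lemma union_labels:
  fixes A B :: "'a::comm_monoid_add set"
  assumes "finite A" "finite B" "inj_on lam A" "inj_on lam B" "lam ` A \<inter> lam ` B = {}"
  shows "inj_on lam (A \<union> B)" "\<Sum>(A \<union> B) = \<Sum>A + \<Sum>B" "card (A \<union> B) = card A + card B"
proof -
  have "A \<inter> B = {}" using assms(5) by blast
  then show "\<Sum>(A \<union> B) = \<Sum>A + \<Sum>B" "card (A \<union> B) = card A + card B"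
    using assms by (auto simp: sum.union_disjoint card_Un_disjoint)
  show "inj_on lam (A \<union> B)" using assms by (subst inj_on_Un) blast
qed

text \<open>\<open>K_eq\<close> lists the combinations of the F_2-basis 1, c, d, in terms of which
  the additional columns are chosen.\<close>

locale octic =
  fixes K :: "gf set" and c d :: gf
  assumes K: "gf_subfield K" and card_K: "card K = 8" and pow8: "\<And>x. x \<in> K \<Longrightarrow> x ^ 8 = x"
    and K_eq: "K = {0, 1, c, c + 1, d, d + 1, c + d, c + d + 1}"
    and basis: "c \<notin> {0, 1}" "d \<notin> {0, 1, c, c + 1}"
begin

lemma cd: "c \<in> K" "d \<in> K" "c + 1 \<in> K" "0 \<in> K" "1 \<in> K"
  by (auto simp: K_eq)

lemma cd_distinct: "c \<noteq> 0" "c \<noteq> 1" "d \<noteq> 0" "d \<noteq> 1" "c \<noteq> d" "d \<noteq> c" "c + 1 \<noteq> d" "d \<noteq> c + 1"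
  "c + 1 \<noteq> 0" "c + 1 \<noteq> 1" "c \<noteq> c + 1" "c + 1 \<noteq> c"
  using basis by auto

text \<open>The columns \<open>fvec u\<close> of the repetition code of length 9: any eight of them form a basis
  of \<open>V0\<close>, and all of them add up to zero.\<close>

definition fvec :: "gf option \<Rightarrow> gf \<Rightarrow> bit" where
  "fvec u = (case u of None \<Rightarrow> (\<lambda>x. of_bool (x \<in> K)) | Some b \<Rightarrow> (\<lambda>x. of_bool (x = b)))"

definition V0 :: "(gf \<Rightarrow> bit) set" where
  "V0 = {g. \<forall>x. x \<notin> K \<longrightarrow> g x = 0}"

definition P :: "gf option set" where
  "P = insert None (Some ` K)"

lemma finite_P: "finite P" and card_P: "card P = 9"
  using subfield_finite[OF K] card_K by (simp_all add: P_def card_image)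

lemma fvec_neq_0: "u \<in> P \<Longrightarrow> fvec u \<noteq> 0"
  using cd by (auto simp: fvec_def P_def fun_eq_iff split: option.splits)

lemma inj_fvec: "inj_on fvec P"
proof (rule inj_onI)
  fix u v assume uv: "u \<in> P" "v \<in> P" "fvec u = fvec v"
  then have "fvec u x = fvec v x" for x by simp
  from this[of 0] this[of 1] this[of "the u"] uv(1,2) show "u = v"
    using cd by (cases u; cases v) (auto simp: fvec_def P_def split: if_splits)
qed

lemma fvec_in_V0: "u \<in> P \<Longrightarrow> fvec u \<in> V0"
  by (auto simp: fvec_def V0_def P_def)

lemma sum_fvec: "finite B \<Longrightarrow> (\<Sum>u\<in>Some ` B. fvec u) = (\<lambda>x. of_bool (x \<in> B))"
proof (induction B rule: finite_induct)
  case (insert b B)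
  then have "(\<Sum>u\<in>Some ` insert b B. fvec u) = fvec (Some b) + (\<lambda>x. of_bool (x \<in> B))"
    by (simp add: image_iff)
  then show ?case using insert.hyps by (auto simp: fvec_def fun_eq_iff)
qed (auto simp: fun_eq_iff)

text \<open>A vector of weight at most 4 is the sum of its unit vectors. Otherwise its complement
  has weight at most 3, and the all-one vector \<open>fvec None\<close> is added.\<close>

lemma V0_eq_sum_fvec:
  assumes "g \<in> V0"
  obtains I where "I \<subseteq> P" "card I \<le> 4" "(\<Sum>u\<in>I. fvec u) = g"
proof -
  define B where "B = {b. g b = 1}"
  have B: "B \<subseteq> K" using assms by (auto simp: B_def V0_def)
  have fin: "finite K" "finite B" using subfield_finite[OF K] B finite_subset by auto
  have g: "g = (\<lambda>x. of_bool (x \<in> B))" by (auto simp: B_def fun_eq_iff)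
  show thesis
  proof (cases "card B \<le> 4")
    case True
    then show ?thesis
      using that[of "Some ` B"] B sum_fvec[OF fin(2)] g by (auto simp: P_def card_image)
  next
    case False
    then have "card (K - B) \<le> 3" using card_K B fin by (simp add: card_Diff_subset)
    moreover have "(\<Sum>u\<in>insert None (Some ` (K - B)). fvec u) = g"
      using fin B sum_fvec[of "K - B"] by (auto simp: g fvec_def fun_eq_iff)
    ultimately show ?thesis
      using that[of "insert None (Some ` (K - B))"] fin by (auto simp: P_def card_image)
  qed
qed

section \<open>The 90 columns in codimension 20 and their parts\<close>

definition groups :: "gf option set \<Rightarrow> ((gf \<Rightarrow> bit) \<times> gf4) set" where
  "groups U = (\<lambda>(u, x). (fvec u, pt u x)) ` (U \<times> K)"

text \<open>The nonzero multiples of the point \<open>Some 0\<close> of the cubic, attached to the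
  zero column.\<close>

definition Xs :: "((gf \<Rightarrow> bit) \<times> gf4) set" where
  "Xs = (\<lambda>x. (0, (x, 0, 0, 0))) ` (K - {0})"

text \<open>Eleven columns that serve the plane of the vectors (0, a, t, 0): every element of F_8 is
  a sum of at most two of 1, c, c + 1, d, and the columns with second coordinate 1 carry any t as
  well.\<close>

definition YZs :: "((gf \<Rightarrow> bit) \<times> gf4) set" where
  "YZs = (\<lambda>t. (0, (0, 1, t, 0))) ` K \<union> (\<lambda>z. (0, (0, z, 0, 0))) ` {c, c + 1, d}"

definition C1 :: "((gf \<Rightarrow> bit) \<times> gf4) set" where
  "C1 = groups P \<union> Xs \<union> YZs"

text \<open>Each group is split into its column with multiplier 0 and the others, so that two of its
  columns may be used at once. \<open>Xs\<close> is a single part, the columns (0, 1, t, 0) are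
  split by t = 0, and those with c, c + 1, d are alone in their parts.\<close>

definition lam1 :: "(gf \<Rightarrow> bit) \<times> gf4 \<Rightarrow> (gf \<Rightarrow> bit) \<times> gf \<times> bool" where
  "lam1 = (\<lambda>(g, y). if g = 0 then (0, fst (snd y), fst (snd (snd y)) = 0) else (g, 0, y = 0))"

lemma lam1_group: "u \<in> P \<Longrightarrow> lam1 (fvec u, pt u x) = (fvec u, 0, x = 0)"
  by (simp add: lam1_def fvec_neq_0 del: pt.simps)

lemma lam1_0: "lam1 (0, (w, z, t, s)) = (0, z, t = 0)"
  by (simp add: lam1_def)

text \<open>The multiples of the point \<open>Some 0\<close> are available in any case, either from its group or from
  \<open>Xs\<close>, so only the last three components matter.  \<open>reach J k e\<close>: the vector \<open>e\<close> is obtained from at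
  most \<open>k\<close> columns outside \<open>Xs\<close> and outside the groups of \<open>Some 0\<close> and of the points in \<open>J\<close>; a group
  contributes here through two of its columns, whose components in \<open>V0\<close> cancel.\<close>

definition reach :: "gf option set \<Rightarrow> nat \<Rightarrow> gf4 \<Rightarrow> bool" where
  "reach J k e \<longleftrightarrow> (\<exists>E\<subseteq>groups (P - insert (Some 0) J) \<union> YZs. finite E \<and> inj_on lam1 E \<and> card E \<le> k \<and> \<Sum>E = (0, e))"

lemma reachI:
  "E \<subseteq> groups (P - insert (Some 0) J) \<union> YZs \<Longrightarrow> finite E \<Longrightarrow> inj_on lam1 E \<Longrightarrow> card E \<le> k \<Longrightarrow>
    \<Sum>E = (0, e) \<Longrightarrow> reach J k e"
  unfolding reach_def by blast

lemma reach_mono: "reach J k e \<Longrightarrow> k \<le> l \<Longrightarrow> reach J l e"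
  unfolding reach_def by (meson le_trans)

lemma reach_0: "reach J k 0"
  by (rule reachI[of "{}"]) (simp_all add: zero_prod_def)

lemma YZs_intros: "t \<in> K \<Longrightarrow> (0, (0, 1, t, 0)) \<in> YZs" "z \<in> {c, c + 1, d} \<Longrightarrow> (0, (0, z, 0, 0)) \<in> YZs"
  by (auto simp: YZs_def)

lemma reach_Y: "t \<in> K \<Longrightarrow> reach J 1 (0, 1, t, 0)"
  by (rule reachI[of "{(0, (0, 1, t, 0))}"]) (auto simp: YZs_intros)

lemma reach_Z: "z \<in> {c, c + 1, d} \<Longrightarrow> reach J 1 (0, z, 0, 0)"
  by (rule reachI[of "{(0, (0, z, 0, 0))}"]) (auto simp: YZs_intros)

text \<open>The second coordinates cancel, and the two columns lie in different parts since only one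
  of them has third coordinate 0.\<close>

lemma reach_YY: "t \<in> K \<Longrightarrow> reach J 2 (0, 0, t, 0)"
proof (cases "t = 0")
  case True
  then show ?thesis using reach_0[of J 2] by (simp add: zero_prod_def)
next
  case False
  assume "t \<in> K"
  then show ?thesis using False cd
    by (intro reachI[of "{(0, (0, 1, 0, 0)), (0, (0, 1, t, 0))}"])
      (auto simp: YZs_intros inj_on_def lam1_0)
qed

lemma Z_neq: "z \<in> {c, c + 1, d} \<Longrightarrow> z \<noteq> 0 \<and> z \<noteq> 1"
  using basis by auto

lemma reach_YZ: "t \<in> K \<Longrightarrow> z \<in> {c, c + 1, d} \<Longrightarrow> reach J 2 (0, 1 + z, t, 0)"
  using Z_neq[of z] by (intro reachI[of "{(0, (0, 1, t, 0)), (0, (0, z, 0, 0))}"])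
    (auto simp: YZs_intros inj_on_def lam1_0)

lemma reach_ZZ: "z \<in> {c, c + 1, d} \<Longrightarrow> z' \<in> {c, c + 1, d} \<Longrightarrow> z \<noteq> z' \<Longrightarrow> reach J 2 (0, z + z', 0, 0)"
  by (intro reachI[of "{(0, (0, z, 0, 0)), (0, (0, z', 0, 0))}"])
    (auto simp: YZs_intros inj_on_def lam1_0)

lemma reach_YZZ:
  "t \<in> K \<Longrightarrow> z \<in> {c, c + 1, d} \<Longrightarrow> z' \<in> {c, c + 1, d} \<Longrightarrow> z \<noteq> z' \<Longrightarrow> reach J 3 (0, 1 + (z + z'), t, 0)"
  using Z_neq[of z] Z_neq[of z']
  by (intro reachI[of "{(0, (0, 1, t, 0)), (0, (0, z, 0, 0)), (0, (0, z', 0, 0))}"])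
    (auto simp: YZs_intros inj_on_def lam1_0)

lemma reach_YYZ: "t \<in> K \<Longrightarrow> z \<in> {c, c + 1, d} \<Longrightarrow> reach J 3 (0, z, t, 0)"
proof (cases "t = 0")
  case True
  assume "z \<in> {c, c + 1, d}"
  then show ?thesis using reach_mono[OF reach_Z[of z J], of 3] True by simp
next
  case False
  assume "t \<in> K" "z \<in> {c, c + 1, d}"
  then show ?thesis using False cd Z_neq[of z]
    by (intro reachI[of "{(0, (0, 1, 0, 0)), (0, (0, 1, t, 0)), (0, (0, z, 0, 0))}"])
      (auto simp: YZs_intros inj_on_def lam1_0)
qed

lemma bit_add_self [simp]: "g + g = (0::gf \<Rightarrow> bit)"
  by (simp add: fun_eq_iff)

lemma groups_intro: "u \<in> U \<Longrightarrow> x \<in> K \<Longrightarrow> (fvec u, pt u x) \<in> groups U"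
  unfolding groups_def by (rule image_eqI[of _ _ "(u, x)"]) auto

text \<open>The columns of \<open>u\<close> with multipliers 0 and x lie in different parts and add
  up to (0, \<open>pt u x\<close>). Their labels have a nonzero first component, unlike those of
  \<open>F\<close>.\<close>

lemma reach_pair_plus:
  assumes u: "u \<in> P - insert (Some 0) J" and x: "x \<in> K" and F: "F \<subseteq> YZs" "finite F" "inj_on lam1 F" "\<Sum>F = (0, e)"
  shows "reach J (2 + card F) (pt u x + e)"
proof (cases "x = 0")
  case True
  have "reach J (card F) e" using F by (intro reachI[of F]) auto
  then show ?thesis using True by (simp add: reach_mono del: pt.simps)
next
  case False
  define A where "A = {(fvec u, pt u 0), (fvec u, pt u x)}"
  have u': "u \<in> P" using u by blast
  have neq: "pt u x \<noteq> 0" using False by simp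
  have A: "finite A" "card A = 2" "\<Sum>A = (0, pt u x)"
    using neq by (auto simp: A_def simp del: pt.simps)
  have fst_A: "fst a \<noteq> 0 \<and> fst (lam1 a) \<noteq> 0" if "a \<in> A" for a
    using that fvec_neq_0[OF u'] lam1_group[OF u'] by (auto simp: A_def simp del: pt.simps pt_0)
  have fst_F: "fst a = 0 \<and> fst (lam1 a) = 0" if "a \<in> F" for a
    using that F(1) by (auto simp: YZs_def lam1_0)
  have "A \<inter> F = {}" "lam1 ` A \<inter> lam1 ` F = {}"
  proof -
    show "A \<inter> F = {}" using fst_A fst_F by blast
    have "lam1 a \<noteq> lam1 b" if "a \<in> A" "b \<in> F" for a b
      using fst_A[OF that(1)] fst_F[OF that(2)] by auto
    then show "lam1 ` A \<inter> lam1 ` F = {}" by blast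
  qed
  moreover have "inj_on lam1 A"
    using False by (auto simp: A_def inj_on_def lam1_group[OF u'] simp del: pt.simps pt_0)
  ultimately have "inj_on lam1 (A \<union> F)"
    using F(3) by (subst inj_on_Un) blast
  moreover have "\<Sum>(A \<union> F) = (0, pt u x + e)"
    using A F \<open>A \<inter> F = {}\<close> by (simp add: sum.union_disjoint)
  moreover have "card (A \<union> F) \<le> 2 + card F" using A by (metis card_Un_le)
  moreover have "A \<subseteq> groups (P - insert (Some 0) J)"
    using groups_intro[OF u cd(4)] groups_intro[OF u x] by (simp add: A_def del: pt.simps)
  ultimately show ?thesis using A F by (intro reachI[of "A \<union> F"]) auto
qed

lemma reach_pair: "u \<in> P - insert (Some 0) J \<Longrightarrow> x \<in> K \<Longrightarrow> reach J 2 (pt u x)"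
proof -
  assume *: "u \<in> P - insert (Some 0) J" "x \<in> K"
  have "\<Sum>{} = (0 :: gf \<Rightarrow> bit, 0 :: gf4)" by (simp add: zero_prod_def)
  then show ?thesis using reach_pair_plus[OF *, of "{}" 0] by (simp del: pt.simps)
qed

lemma reach_pair_Y: "u \<in> P - insert (Some 0) J \<Longrightarrow> x \<in> K \<Longrightarrow> t \<in> K \<Longrightarrow> reach J 3 (pt u x + (0, 1, t, 0))"
  using reach_pair_plus[of u J x "{(0, (0, 1, t, 0))}"] by (simp add: YZs_intros del: pt.simps)

lemma reach_axis: "a \<in> K \<Longrightarrow> reach J 2 (0, a, 0, 0)"
proof -
  assume "a \<in> K"
  then consider "a = 0" | "a = 1" | "a = c \<or> a = c + 1 \<or> a = d" | "a = d + 1" | "a = c + d" | "a = (c + 1) + d"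
    by (auto simp: K_eq add.assoc add.commute)
  then show ?thesis
  proof cases
    case 1 then show ?thesis using reach_0[of J 2] by (simp add: zero_prod_def)
  next
    case 2 then show ?thesis using reach_mono[OF reach_Y[of 0 J], of 2] cd by simp
  next
    case 3 then show ?thesis using reach_mono[OF reach_Z[of a J], of 2] by simp
  next
    case 4 then show ?thesis using reach_YZ[of 0 d J] cd by (simp add: add.commute)
  next
    case 5 then show ?thesis using reach_ZZ[of c d J] cd_distinct by simp
  next
    case 6 then show ?thesis using reach_ZZ[of "c + 1" d J] cd_distinct by simp
  qed
qed

text \<open>For a other than 0 and d, a is 1 plus a sum of at most two of c, c + 1, d, so a single
  column (0, 1, t, 0) supplies t. The values 0 and d are left to \<open>reach_YY\<close> and
  \<open>reach_YYZ\<close>.\<close>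

lemma reach_plane: "a \<in> K \<Longrightarrow> t \<in> K \<Longrightarrow> reach J 3 (0, a, t, 0)"
proof -
  assume "a \<in> K" and t: "t \<in> K"
  then consider "a = 0" | "a = 1" | "a = 1 + c" | "a = 1 + (c + 1)" | "a = d" | "a = 1 + d"
    | "a = 1 + (c + d)" | "a = 1 + ((c + 1) + d)"
    by (auto simp: K_eq add.assoc add.commute add.left_commute)
  then show ?thesis
  proof cases
    case 1 then show ?thesis using reach_mono[OF reach_YY[OF t, of J], of 3] by simp
  next
    case 2 then show ?thesis using reach_mono[OF reach_Y[OF t, of J], of 3] by simp
  next
    case 3 then show ?thesis using reach_mono[OF reach_YZ[OF t, of c J], of 3] by simp
  next
    case 4 then show ?thesis using reach_mono[OF reach_YZ[OF t, of "c + 1" J], of 3] by simp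
  next
    case 5 then show ?thesis using reach_YYZ[OF t, of d J] by simp
  next
    case 6 then show ?thesis using reach_mono[OF reach_YZ[OF t, of d J], of 3] by simp
  next
    case 7 then show ?thesis using reach_YZZ[OF t, of c d J] cd_distinct by simp
  next
    case 8 then show ?thesis using reach_YZZ[OF t, of "c + 1" d J] cd_distinct by simp
  qed
qed


section \<open>Matching the last three coordinates\<close>

lemma K_intros: "x \<in> K \<Longrightarrow> y \<in> K \<Longrightarrow> x + y \<in> K" "x \<in> K \<Longrightarrow> y \<in> K \<Longrightarrow> x * y \<in> K"
  "x \<in> K \<Longrightarrow> y \<in> K \<Longrightarrow> x / y \<in> K" "x \<in> K \<Longrightarrow> x ^ n \<in> K" "0 \<in> K" "1 \<in> K"
  using subfield_intros[OF K] by auto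

text \<open>The first coordinate is left open, to be corrected by a multiple of the point
  \<open>Some 0\<close>.\<close>

definition solves :: "gf option set \<Rightarrow> gf4 \<Rightarrow> (gf option \<Rightarrow> gf) \<Rightarrow> gf4 \<Rightarrow> bool" where
  "solves J y \<xi> e \<longleftrightarrow> (\<forall>u\<in>J. \<xi> u \<in> K) \<and> snd (e + (\<Sum>u\<in>J. pt u (\<xi> u))) = snd y"

text \<open>Together with \<open>Some 0\<close> there are four points; dropping the multiple of
  \<open>Some 0\<close> changes the first coordinate only.\<close>

lemma reach_complete_3:
  assumes J: "J \<subseteq> P - {Some 0}" "card J = 3" and y: "y \<in> pow4 K"
  shows "\<exists>\<xi> e. solves J y \<xi> e \<and> reach J 0 e"
proof -
  have fin: "finite J" using J(2) by (metis card.infinite zero_neq_numeral)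
  have notin: "Some 0 \<notin> J" using J(1) by blast
  have "card (insert (Some 0) J) = 4" "insert (Some 0) J \<subseteq> insert None (Some ` K)"
    using J notin fin cd(4) by (auto simp: P_def)
  then obtain \<xi> where \<xi>: "\<And>u. \<xi> u \<in> K" "(\<Sum>u\<in>insert (Some 0) J. pt u (\<xi> u)) = y"
    using arc_solve[OF K _ _ y] by blast
  then have "pt (Some 0) (\<xi> (Some 0)) + (\<Sum>u\<in>J. pt u (\<xi> u)) = y"
    using fin notin by (simp del: pt.simps)
  then have "snd (\<Sum>u\<in>J. pt u (\<xi> u)) = snd y"
    by (auto simp: zero_prod_def[symmetric])
  then have "solves J y \<xi> 0" using \<xi>(1) by (simp add: solves_def)
  then show ?thesis using reach_0 by blast
qed

text \<open>One column (0, 1, t, 0) is used. The second and fourth coordinates determine the two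
  coefficients over \<open>J\<close>, and t absorbs the third.\<close>

lemma reach_complete_2:
  assumes J: "J \<subseteq> P - {Some 0}" "card J = 2" and y: "y \<in> pow4 K"
  shows "\<exists>\<xi> e. solves J y \<xi> e \<and> reach J 1 e"
proof -
  obtain y0 y1 y2 y3 where y_eq: "y = (y0, y1, y2, y3)" by (metis prod_cases4)
  have yK: "y1 \<in> K" "y2 \<in> K" "y3 \<in> K" using y by (auto simp: y_eq pow4_def)
  obtain u v where uv: "J = {u, v}" "u \<noteq> v" "v \<noteq> None"
    using J(2) by (metis card_2_iff insert_commute)
  then obtain k where k: "v = Some k" "k \<in> K" "k \<noteq> 0"
    using J(1) by (auto simp: P_def)
  show ?thesis
  proof (cases u)
    case None
    define A where "A = (y1 + 1) / k"
    define \<xi> where "\<xi> = (\<lambda>w::gf option. if w = None then y3 + A * k ^ 3 else A)"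
    have AK: "A \<in> K" "y3 + A * k ^ 3 \<in> K" "y2 + A * k ^ 2 \<in> K"
      unfolding A_def using yK k by (simp_all add: K_intros)
    have Ak: "A * k = y1 + 1" using k by (simp add: A_def)
    have "solves J y \<xi> (0, 1, y2 + A * k ^ 2, 0)"
      using AK uv k None Ak by (simp add: solves_def \<xi>_def y_eq)
    then show ?thesis using reach_Y[OF AK(3)] by blast
  next
    case (Some j)
    then have j: "j \<in> K" "j \<noteq> 0" "j \<noteq> k" using J(1) uv k by (auto simp: P_def)
    define m where "m = y1 + 1"
    \<comment> \<open>\<open>A\<close> and \<open>B\<close> are the coefficients of the points j and
      k, multiplied by j and k. They solve A + B = y1 + 1 and A j^2 + B k^2 = y3, with determinant
      (j + k)^2.\<close>
    define A where "A = (y3 + m * k ^ 2) / (j ^ 2 + k ^ 2)"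
    have "j ^ 2 + k ^ 2 = (j + k) ^ 2" by (simp add: power2_eq_square algebra_simps)
    then have ne: "j ^ 2 + k ^ 2 \<noteq> 0" using j by simp
    define B where "B = A + m"
    have eq3: "A * j ^ 2 + B * k ^ 2 = y3"
    proof -
      have "A * j ^ 2 + B * k ^ 2 = A * (j ^ 2 + k ^ 2) + m * k ^ 2"
        by (simp add: B_def algebra_simps)
      then show ?thesis using ne by (simp add: A_def add.assoc)
    qed
    have mK: "m \<in> K" unfolding m_def using yK by (intro K_intros)
    have AK: "A \<in> K" unfolding A_def using yK j k mK by (intro K_intros)
    have BK: "B \<in> K" unfolding B_def using AK mK by (intro K_intros)
    have tK: "y2 + A * j + B * k \<in> K" "A / j \<in> K" "B / k \<in> K"
      using AK BK yK j k by (simp_all add: K_intros)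
    define \<xi> where "\<xi> = (\<lambda>w::gf option. if w = Some j then A / j else B / k)"
    have "A / j * j ^ 2 = A * j" "B / k * k ^ 2 = B * k" "A / j * j ^ 3 = A * j ^ 2" "B / k * k ^ 3 = B * k ^ 2"
      using j k by (simp_all add: power2_eq_square power3_eq_cube)
    moreover have "1 + (A + B) = y1" by (simp add: B_def m_def add_ac)
    ultimately have "solves J y \<xi> (0, 1, y2 + A * j + B * k, 0)"
      using j k tK uv Some eq3 by (simp add: solves_def \<xi>_def y_eq)
    then show ?thesis using reach_Y[OF tK(1)] by blast
  qed
qed

lemma reach_complete_1:
  assumes J: "J \<subseteq> P - {Some 0}" "card J = 1" and y: "y \<in> pow4 K"
  shows "\<exists>\<xi> e. solves J y \<xi> e \<and> reach J 2 e"
proof -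
  obtain y0 y1 y2 y3 where y_eq: "y = (y0, y1, y2, y3)" by (metis prod_cases4)
  have yK: "y1 \<in> K" "y2 \<in> K" "y3 \<in> K" using y by (auto simp: y_eq pow4_def)
  obtain u where u: "J = {u}" using J(2) card_1_singletonE by blast
  show ?thesis
  proof (cases u)
    case None
    \<comment> \<open>Infinity settles the last coordinate, so only \<open>y1\<close> and
      \<open>y2\<close> have to be met.\<close>
    have *: ?thesis if "reach J 2 (e0, y1, y2, e3)" "e3 \<in> K" for e0 e3
    proof -
      have "solves J y (\<lambda>_. y3 + e3) (e0, y1, y2, e3)"
        using None u K_intros(1)[OF yK(3) that(2)] by (simp add: solves_def y_eq)
      then show ?thesis using that by blast
    qed
    consider "y1 = 0" | "y2 = 0" | "y1 \<noteq> 0" "y2 \<noteq> 0" by blast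
    then show ?thesis
    proof cases
      case 1 then show ?thesis using *[of 0 0] reach_YY[of y2 J] yK by auto
    next
      case 2 then show ?thesis using *[of 0 0] reach_axis[of y1 J] yK by auto
    next
      case 3
      \<comment> \<open>A pair at the finite point b needs x b = y1 and x b^2 = y2, which forces b =
        y2 / y1 and x = y1^2 / y2.\<close>
      have "Some (y2 / y1) \<in> P - insert (Some 0) J"
        using 3 K_intros(3)[OF yK(2,1)] u None by (simp add: P_def)
      then have "reach J 2 (pt (Some (y2 / y1)) (y1 ^ 2 / y2))" 
        using K_intros(3)[OF K_intros(4)[OF yK(1)] yK(2)] by (rule reach_pair)
      moreover have "(y1 ^ 2 / y2) * (y2 / y1) ^ 3 \<in> K"
        using yK by (intro K_intros)
      ultimately show ?thesis using 3
        by (intro *[of "y1 ^ 2 / y2" "(y1 ^ 2 / y2) * (y2 / y1) ^ 3"]) (simp_all add: power2_eq_square)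
    qed
  next
    case (Some j)
    then have j: "j \<in> K" "j \<noteq> 0" using J(1) u by (auto simp: P_def)
    \<comment> \<open>The forms defining \<open>a\<close> and \<open>b\<close> vanish on the
      multiples of the point j. A vector with the same values differs from y by such a multiple, as
      far as the last three coordinates are concerned.\<close>
    define a where "a = y2 + j * y1"
    define b where "b = y3 + j * y2"
    have ab: "a \<in> K" "b \<in> K" unfolding a_def b_def using yK j by (simp_all add: K_intros)
    have *: ?thesis if "reach J 2 (e0, e1, e2, e3)" "e1 \<in> K" "e2 + j * e1 = a" "e3 + j * e2 = b" for e0 e1 e2 e3
    proof -
      define x where "x = (y1 + e1) / j"
      have x: "x * j = y1 + e1" using j by (simp add: x_def)
      have e2: "e2 = y2 + j * (x * j)" using that(3) x by (simp add: a_def algebra_simps) (metis gf_add_self_left add.assoc add.commute)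
      have e3: "e3 = y3 + j * (j * (x * j))" using that(4) e2 by (simp add: b_def algebra_simps) (metis gf_add_self_left add.assoc add.commute)
      have "x \<in> K" unfolding x_def using yK(1) j(1) that(2) by (intro K_intros)
      moreover have "snd (pt (Some j) x) = (x * j, j * (x * j), j * (j * (x * j)))"
        by (simp add: power2_eq_square power3_eq_cube mult_ac)
      ultimately have "solves J y (\<lambda>_. x) (e0, e1, e2, e3)"
        using Some u x unfolding e2 e3 by (simp add: solves_def y_eq)
      then show ?thesis using that(1) by blast
    qed
    \<comment> \<open>The cases are met by (0, a / j, 0, 0), by (0, 0, a, 0), by a multiple of
      infinity, and by a multiple x of the point k = b / a, where x k (k + j) = a.\<close>
    consider "b = 0" | "b = j * a" | "a = 0" "b \<noteq> 0" | "a \<noteq> 0" "b \<noteq> 0" "b \<noteq> j * a" by blast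
    then show ?thesis
    proof cases
      case 1 then show ?thesis using *[of 0 "a / j" 0 0] reach_axis[of "a / j" J] K_intros(3)[OF ab(1) j(1)] K_intros(5) j by simp
    next
      case 2 then show ?thesis using *[of 0 0 a 0] reach_YY[of a J] ab K_intros(5) 2 by simp
    next
      case 3
      have "reach J 2 (pt None b)" by (rule reach_pair) (use ab u Some in \<open>auto simp: P_def\<close>)
      then show ?thesis using *[of 0 0 0 b] 3 K_intros(5) by simp
    next
      case 4
      define k where "k = b / a"
      have k: "k \<in> K" "k \<noteq> 0" "k \<noteq> j" "a * k = b" using 4 K_intros(3)[OF ab(2,1)] by (auto simp: k_def)
      then have kj: "k + j \<noteq> 0" by simp
      define x where "x = a / (k * (k + j))"
      have xk: "x * k * (k + j) = a" using k(2) kj by (simp add: x_def)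
      have "x \<in> K" unfolding x_def using ab(1) k(1) j(1) by (intro K_intros)
      then have "reach J 2 (pt (Some k) x)"
        using k u Some by (intro reach_pair) (auto simp: P_def)
      moreover have "x * k ^ 2 + j * (x * k) = x * k * (k + j)"
        "x * k ^ 3 + j * (x * k ^ 2) = (x * k * (k + j)) * k"
        by (simp_all add: power2_eq_square power3_eq_cube algebra_simps)
      then have "x * k ^ 2 + j * (x * k) = a" "x * k ^ 3 + j * (x * k ^ 2) = b"
        by (simp_all only: xk k(4))
      ultimately show ?thesis using K_intros(2)[OF \<open>x \<in> K\<close> k(1)]
        by (intro *[of x "x * k" "x * k ^ 2" "x * k ^ 3"]) simp_all
    qed
  qed
qed

text \<open>Three columns must match y1, y2, y3 by themselves. Unless y3 = 0, a pair from one group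
  and a column (0, 1, t, 0) are used: the group of infinity if y1 = 1, else that of the point k with
  x k = y1 + 1 and x k^3 = y3, so that k is a square root of y3 / (y1 + 1).\<close>

lemma reach_complete_0:
  assumes y: "y \<in> pow4 K"
  shows "\<exists>\<xi> e. solves {} y \<xi> e \<and> reach {} 3 e"
proof -
  obtain y0 y1 y2 y3 where y_eq: "y = (y0, y1, y2, y3)" by (metis prod_cases4)
  have yK: "y1 \<in> K" "y2 \<in> K" "y3 \<in> K" using y by (auto simp: y_eq pow4_def)
  have *: ?thesis if "reach {} 3 (e0, y1, y2, y3)" for e0
    using that by (auto simp: solves_def y_eq)
  consider "y3 = 0" | "y3 \<noteq> 0" "y1 = 1" | "y3 \<noteq> 0" "y1 \<noteq> 1" by blast
  then show ?thesis
  proof cases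
    case 1 then show ?thesis using *[of 0] reach_plane[of y1 y2 "{}"] yK by simp
  next
    case 2
    then show ?thesis
      using *[of 0] reach_pair_Y[of None "{}" y3 y2] yK by (simp add: P_def)
  next
    case 3
    define m where "m = y1 + 1"
    have m: "m \<in> K" "m \<noteq> 0" using K_intros(1)[OF yK(1) K_intros(6)] 3 by (auto simp: m_def)
    \<comment> \<open>Squaring is inverted by the fourth power, since \<open>x ^ 8 = x\<close>.\<close>
    define k where "k = (y3 / m) ^ 4"
    have "k ^ 2 = (y3 / m) ^ 8" by (simp add: k_def flip: power_mult)
    also have "\<dots> = y3 / m" using yK m by (intro pow8 K_intros)
    finally have k2: "m * k ^ 2 = y3" using m by simp
    have "k \<in> K" unfolding k_def using yK m by (intro K_intros)
    then have k: "k \<in> K" "k \<noteq> 0" using m 3 by (auto simp: k_def)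
    define x where "x = m / k"
    have x: "x \<in> K" "x * k = m" using K_intros(3)[OF m(1) k(1)] k by (auto simp: x_def)
    have "reach {} 3 (pt (Some k) x + (0, 1, y2 + x * k ^ 2, 0))"
    proof (rule reach_pair_Y)
      show "Some k \<in> P - insert (Some 0) {}" using k by (simp add: P_def)
      show "y2 + x * k ^ 2 \<in> K" using yK x k by (intro K_intros)
    qed (rule x)
    moreover have "x * k ^ 3 = y3" "x * k + 1 = y1"
      using x(2) k2 by (auto simp: power3_eq_cube power2_eq_square mult_ac m_def)
    ultimately show ?thesis using *[of x] by (simp add: add_ac)
  qed
qed

text \<open>The columns over \<open>J\<close> and the further ones number at most three, which
  leaves a fourth for the multiple of \<open>Some 0\<close>.\<close>

lemma reach_complete:
  assumes J: "J \<subseteq> P - {Some 0}" "card J \<le> 3" and y: "y \<in> pow4 K"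
  obtains \<xi> e where "solves J y \<xi> e" "reach J (3 - card J) e"
proof -
  have fin: "finite J" using J(1) finite_P by (meson finite_Diff finite_subset)
  consider "J = {}" | "card J = 1" | "card J = 2" | "card J = 3" using J(2) fin
    by (metis One_nat_def Suc_1 card_0_eq le_SucE le_zero_eq numeral_3_eq_3)
  then have "\<exists>\<xi> e. solves J y \<xi> e \<and> reach J (3 - card J) e"
    by cases (use reach_complete_0[OF y] reach_complete_1[OF J(1) _ y] reach_complete_2[OF J(1) _ y]
      reach_complete_3[OF J(1) _ y] in simp_all)
  then show thesis using that by blast
qed


section \<open>Assembling a sum of at most four columns\<close>

lemma group_columns:
  assumes "J \<subseteq> P" "finite J" "\<And>u. u \<in> J \<Longrightarrow> \<xi> u \<in> K"
  defines "A \<equiv> (\<lambda>u. (fvec u, pt u (\<xi> u))) ` J"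
  shows "A \<subseteq> groups P" "finite A" "card A = card J" "inj_on lam1 A"
    "\<Sum>A = (\<Sum>u\<in>J. fvec u, \<Sum>u\<in>J. pt u (\<xi> u))" "fst ` lam1 ` A = fvec ` J"
proof -
  have inj: "inj_on fvec J" using inj_fvec assms(1) by (rule inj_on_subset)
  have inj': "inj_on (\<lambda>u. (fvec u, pt u (\<xi> u))) J" using inj by (auto simp: inj_on_def)
  show "A \<subseteq> groups P" unfolding A_def using assms groups_intro by blast
  show "finite A" "card A = card J" using assms(2) inj' by (auto simp: A_def card_image)
  have *: "fst (lam1 (fvec u, pt u (\<xi> u))) = fvec u" if "u \<in> J" for u
    using that assms(1) lam1_group[of u] by auto
  then show "fst ` lam1 ` A = fvec ` J" by (auto simp: A_def image_image)
  show "inj_on lam1 A"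
  proof (rule inj_onI)
    fix a b assume ab: "a \<in> A" "b \<in> A" "lam1 a = lam1 b"
    then obtain u v where uv: "u \<in> J" "v \<in> J" "a = (fvec u, pt u (\<xi> u))" "b = (fvec v, pt v (\<xi> v))"
      by (auto simp: A_def)
    then have "fvec u = fvec v" using ab(3) *[of u] *[of v] by simp
    then have "u = v" using uv inj by (simp add: inj_on_def)
    then show "a = b" using uv by simp
  qed
  show "\<Sum>A = (\<Sum>u\<in>J. fvec u, \<Sum>u\<in>J. pt u (\<xi> u))"
    unfolding A_def using inj' by (subst sum.reindex) (auto simp: sum_pair)
qed

lemma C1_in: "C1 \<subseteq> V0 \<times> pow4 K"
proof -
  have "groups P \<subseteq> V0 \<times> pow4 K"
    using fvec_in_V0 pt_in_pow4[OF K] by (auto simp: groups_def P_def simp del: pt.simps)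
  moreover have "0 \<in> V0" by (simp add: V0_def)
  then have "Xs \<union> YZs \<subseteq> V0 \<times> pow4 K"
    using cd K_intros by (auto simp: Xs_def YZs_def pow4_def)
  ultimately show ?thesis by (auto simp: C1_def)
qed

lemma fst_snd_sum_in_K: "E \<subseteq> C1 \<Longrightarrow> fst (snd (\<Sum>E)) \<in> K"
proof (induction E rule: infinite_finite_induct)
  case (insert a E)
  then have "fst (snd a) \<in> K" using C1_in by (auto simp: pow4_def)
  then show ?case using insert by (simp add: K_intros)
qed (simp_all add: K_intros)

lemma P_0: "Some 0 \<in> P"
  using cd by (simp add: P_def)

text \<open>Four indices without \<open>Some 0\<close> are handled by \<open>arc_solve\<close>
  alone. Otherwise at most three remain once \<open>Some 0\<close> is removed, and
  \<open>reach_complete\<close> applies to them.\<close>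

lemma C1_covers_le_4:
  assumes g: "g \<in> V0" and y: "y \<in> pow4 K"
  shows "\<exists>S\<subseteq>C1. finite S \<and> card S \<le> 4 \<and> inj_on lam1 S \<and> \<Sum>S = (g, y)"
proof -
  obtain I where I: "I \<subseteq> P" "card I \<le> 4" "(\<Sum>u\<in>I. fvec u) = g" using V0_eq_sum_fvec[OF g] .
  have finI: "finite I" using I(1) finite_P by (rule finite_subset)
  show ?thesis
  proof (cases "card I = 4 \<and> Some 0 \<notin> I")
    case True
    then obtain \<xi> where \<xi>: "\<And>u. \<xi> u \<in> K" "(\<Sum>u\<in>I. pt u (\<xi> u)) = y"
      using arc_solve[OF K _ _ y, of I] I(1) by (auto simp: P_def)
    then show ?thesis using group_columns[OF I(1) finI, of \<xi>] I
      by (intro exI[of _ "(\<lambda>u. (fvec u, pt u (\<xi> u))) ` I"]) (auto simp: C1_def)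
  next
    case False
    define J where "J = I - {Some 0}"
    have J: "J \<subseteq> P - {Some 0}" "card J \<le> 3" "finite J"
      using I False finI by (auto simp: J_def card_Diff_singleton_if)
    obtain \<xi> e where sol: "solves J y \<xi> e" and "reach J (3 - card J) e"
      using reach_complete[OF J(1,2) y] .
    then obtain E where E: "E \<subseteq> groups (P - insert (Some 0) J) \<union> YZs" "finite E" "inj_on lam1 E"
      "card E \<le> 3 - card J" "\<Sum>E = (0, e)" unfolding reach_def by blast
    have \<xi>: "\<And>u. u \<in> J \<Longrightarrow> \<xi> u \<in> K" using sol by (simp add: solves_def)
    define A where "A = (\<lambda>u. (fvec u, pt u (\<xi> u))) ` J"
    have JP: "J \<subseteq> P" using J(1) by blast
    note A = group_columns[of J \<xi>, OF JP J(3) \<xi>, folded A_def]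
    have EC: "E \<subseteq> C1" using E(1) by (auto simp: C1_def groups_def)
    \<comment> \<open>The multiple of \<open>Some 0\<close> that the first coordinate still
      lacks.\<close>
    define r where "r = fst y + fst (e + (\<Sum>u\<in>J. pt u (\<xi> u)))"
    have "fst e \<in> K" using fst_snd_sum_in_K[OF EC] E(5) by simp
    moreover have "fst (\<Sum>u\<in>J. pt u (\<xi> u)) \<in> K"
      using fst_snd_sum_in_K[of A] A(1,5) by (auto simp: C1_def)
    ultimately have rK: "r \<in> K" using y by (auto simp: r_def pow4_def intro!: K_intros)
    have y_eq: "e + (\<Sum>u\<in>J. pt u (\<xi> u)) + (r, 0, 0, 0) = y"
      using sol unfolding solves_def r_def
      by (cases y; cases "e + (\<Sum>u\<in>J. pt u (\<xi> u))") (simp add: add_ac)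
    \<comment> \<open>If \<open>Some 0\<close> is among the indices, its group supplies both
      \<open>fvec (Some 0)\<close> and the multiple r. Otherwise r comes from \<open>Xs\<close>,
      where 0 has no column.\<close>
    define B where "B = (if Some 0 \<in> I then {(fvec (Some 0), pt (Some 0) r)} else if r = 0 then {} else {(0, (r, 0, 0, 0))})"
    have B: "B \<subseteq> C1" "finite B" "card B \<le> 1" "inj_on lam1 B"
      using rK groups_intro[OF P_0 rK] by (auto simp: B_def C1_def Xs_def simp del: pt.simps)
    have sumB: "\<Sum>B = (if Some 0 \<in> I then fvec (Some 0) else 0, (r, 0, 0, 0))"
      by (auto simp: B_def zero_prod_def)
    \<comment> \<open>The parts used by \<open>A\<close>, \<open>B\<close> and \<open>E\<close> are
      told apart by the first component of the label; between \<open>Xs\<close> and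
      \<open>YZs\<close> by the second, which is zero only for \<open>Xs\<close>.\<close>
    have lamB: "l = (0, 0, True) \<or> fst l = fvec (Some 0)" if "l \<in> lam1 ` B" for l
      using that lam1_group[OF P_0, of r] by (auto simp: B_def lam1_0 simp del: pt.simps split: if_splits)
    have lamE: "(fst l = 0 \<and> fst (snd l) \<noteq> 0) \<or> fst l \<in> fvec ` (P - insert (Some 0) J)" if "l \<in> lam1 ` E" for l
    proof -
      obtain a where a: "a \<in> E" "l = lam1 a" using \<open>l \<in> lam1 ` E\<close> by blast
      show ?thesis
      proof (cases "a \<in> YZs")
        case True
        then show ?thesis using Z_neq a(2) by (auto simp: YZs_def lam1_0)
      next
        case False
        then have "a \<in> groups (P - insert (Some 0) J)" using E(1) a(1) by blast
        then obtain u x where "u \<in> P - insert (Some 0) J" "a = (fvec u, pt u x)"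
          by (auto simp: groups_def)
        then show ?thesis using lam1_group[of u x] a(2) by auto
      qed
    qed
    have lamA: "fst l \<in> fvec ` J" if "l \<in> lam1 ` A" for l
      using that A(6) by blast
    have f0: "0 \<notin> fvec ` P" using fvec_neq_0 by (auto simp: image_iff dest: sym)
    have fd: "fvec ` U \<inter> fvec ` W = {}" if "U \<subseteq> P" "W \<subseteq> P" "U \<inter> W = {}" for U W
      using inj_on_image_Int[OF inj_fvec that(1,2)] that(3) by simp
    have disjAB: "lam1 ` A \<inter> lam1 ` B = {}"
    proof (rule ccontr)
      assume "\<not> ?thesis"
      then obtain l where l: "l \<in> lam1 ` A" "l \<in> lam1 ` B" by blast
      have "fst l \<noteq> 0" using lamA[OF l(1)] f0 JP by auto
      moreover have "fvec ` J \<inter> fvec ` {Some 0} = {}"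
        using J(1) P_0 by (intro fd) auto
      ultimately show False
        using lamA[OF l(1)] lamB[OF l(2)] by auto
    qed
    note AB = union_labels[OF A(2) B(2) A(4) B(4) disjAB]
    have disjE: "lam1 ` (A \<union> B) \<inter> lam1 ` E = {}"
    proof (rule ccontr)
      assume "\<not> ?thesis"
      then obtain l where l: "l \<in> lam1 ` A \<or> l \<in> lam1 ` B" "l \<in> lam1 ` E" by blast
      have fl: "l = (0, 0, True) \<or> fst l \<in> fvec ` (insert (Some 0) J)"
        using l(1) lamA lamB by blast
      have "insert (Some 0) J \<subseteq> P" using JP P_0 by blast
      then show False
        using fl lamE[OF l(2)] f0 fd[of "insert (Some 0) J" "P - insert (Some 0) J"] by auto
    qed
    note ABE = union_labels[OF finite_UnI[OF A(2) B(2)] E(2) AB(1) E(3) disjE]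
    have "(\<Sum>u\<in>J. fvec u) + (if Some 0 \<in> I then fvec (Some 0) else 0) = g"
      using I(3) finI by (auto simp: J_def sum.remove[of I "Some 0"] add.commute)
    then have "\<Sum>(A \<union> B \<union> E) = (g, y)"
      using ABE(2) AB(2) A(5) sumB E(5) y_eq by (simp add: add_ac)
    moreover have "card (A \<union> B \<union> E) \<le> 4"
      using ABE(3) AB(3) A(3) B(3) E(4) J(2) by linarith
    moreover have "A \<union> B \<union> E \<subseteq> C1" using A(1) B(1) EC by (auto simp: C1_def)
    ultimately show ?thesis using ABE(1) A(2) B(2) E(2)
      by (intro exI[of _ "A \<union> B \<union> E"]) auto
  qed
qed

section \<open>Sums of at least two columns\<close>

definition Ts :: "((gf \<Rightarrow> bit) \<times> gf4) set" where
  "Ts = {(0, (0, 1, 0, 0)), (0, (0, c, 0, 0)), (0, (0, c + 1, 0, 0))}"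

lemma Ts: "Ts \<subseteq> C1" "finite Ts" "card Ts = 3" "inj_on lam1 Ts" "\<Sum>Ts = 0"
proof -
  show "Ts \<subseteq> C1" using cd by (auto simp: Ts_def C1_def YZs_def)
  show "finite Ts" "card Ts = 3" "inj_on lam1 Ts" "\<Sum>Ts = 0"
    using cd_distinct by (auto simp: Ts_def lam1_0 inj_on_def zero_prod_def add_ac)
qed

text \<open>The three parts are singletons: the split by t = 0 isolates (0, 1, 0, 0), and the other
  two columns are alone with their second coordinate.\<close>

lemma lam1_Ts:
  assumes "s \<in> C1" "lam1 s \<in> lam1 ` Ts"
  shows "s \<in> Ts"
proof -
  have Ts_lab: "fst l = 0 \<and> fst (snd l) \<in> {1, c, c + 1} \<and> snd (snd l)" if "l \<in> lam1 ` Ts" for l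
    using that by (auto simp: Ts_def lam1_0)
  consider "s \<in> groups P" | "s \<in> Xs" | "s \<in> YZs" using assms(1) by (auto simp: C1_def)
  then show ?thesis
  proof cases
    case 1
    then obtain u x where "u \<in> P" "s = (fvec u, pt u x)" by (auto simp: groups_def)
    then show ?thesis using Ts_lab[OF assms(2)] lam1_group[of u x] fvec_neq_0[of u] by auto
  next
    case 2
    then show ?thesis using Ts_lab[OF assms(2)] cd_distinct by (auto simp: Xs_def lam1_0)
  next
    case 3
    then show ?thesis using Ts_lab[OF assms(2)] cd_distinct by (auto simp: YZs_def lam1_0 Ts_def)
  qed
qed

lemma card_C1: "card C1 = 90" and finite_C1: "finite C1" and C1_neq_0: "0 \<notin> C1"
proof -
  have finK: "finite K" using subfield_finite[OF K] .
  have "inj_on (\<lambda>(u, x). (fvec u, pt u x)) (P \<times> K)"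
    using inj_fvec by (auto simp: inj_on_def dest: pt_inject simp del: pt.simps)
  then have G: "card (groups P) = 72" "finite (groups P)"
    using card_P card_K finite_P finK by (simp_all add: groups_def card_image card_cartesian_product)
  have X: "card Xs = 7" "finite Xs"
    using card_K finK cd(4) by (auto simp: Xs_def card_image inj_on_def)
  have "(\<lambda>t. (0 :: gf \<Rightarrow> bit, (0 :: gf, 1 :: gf, t, 0 :: gf))) ` K
      \<inter> (\<lambda>z. (0, (0, z, 0, 0))) ` {c, c + 1, d} = {}"
    using cd_distinct by auto
  moreover have "card ((\<lambda>t. (0 :: gf \<Rightarrow> bit, (0 :: gf, 1 :: gf, t, 0 :: gf))) ` K) = 8"
    using card_K by (simp add: card_image inj_on_def)
  moreover have "card ((\<lambda>z. (0 :: gf \<Rightarrow> bit, (0 :: gf, z, 0 :: gf, 0 :: gf))) ` {c, c + 1, d}) = 3"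
    using cd_distinct by (subst card_image) (auto simp: inj_on_def)
  ultimately have YZ: "card YZs = 11" "finite YZs"
    unfolding YZs_def using finK by (simp_all add: card_Un_disjoint del: image_insert)
  have "groups P \<inter> (Xs \<union> YZs) = {}"
    using fvec_neq_0 by (auto simp: groups_def Xs_def YZs_def simp del: pt.simps)
  moreover have "Xs \<inter> YZs = {}" using cd_distinct by (auto simp: Xs_def YZs_def)
  ultimately show "card C1 = 90" "finite C1"
    using G X YZ by (simp_all add: C1_def card_Un_disjoint Int_Un_distrib2 Un_assoc)
  have "(0, 0) \<notin> C1"
    using fvec_neq_0 cd_distinct by (auto simp: C1_def groups_def Xs_def YZs_def zero_prod_def simp del: pt.simps)
  then show "0 \<notin> C1" by (simp add: zero_prod_def)
qed

text \<open>Short sums are lengthened by \<open>Ts\<close>, whose sum is 0: the empty sum becomes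
  \<open>Ts\<close>, a column of \<open>Ts\<close> becomes the sum of the other two, and any other
  single column is joined by all three.\<close>

lemma C1_cover: "labelled_cover (V0 \<times> pow4 K) C1 lam1 2"
proof -
  have add_self: "s + s = 0" for s :: "(gf \<Rightarrow> bit) \<times> gf4"
    by (cases s) (simp add: zero_prod_def)
  have "\<exists>S\<subseteq>C1. 2 \<le> card S \<and> card S \<le> 4 \<and> inj_on lam1 S \<and> \<Sum>S = v" if v: "v \<in> V0 \<times> pow4 K" for v
  proof -
    obtain S where S: "S \<subseteq> C1" "finite S" "card S \<le> 4" "inj_on lam1 S" "\<Sum>S = v"
      using C1_covers_le_4[of "fst v" "snd v"] v by auto
    consider "S = {}" | s where "S = {s}" "s \<in> Ts" | s where "S = {s}" "s \<notin> Ts" | "2 \<le> card S"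
      using S(2) by (metis One_nat_def Suc_1 card_0_eq card_1_singletonE le_SucE nat_le_linear le_zero_eq)
    then show ?thesis
    proof cases
      case 1
      then show ?thesis using Ts S(5) by (intro exI[of _ Ts]) auto
    next
      case 2
      have "s + \<Sum>(Ts - {s}) = 0" using sum.remove[OF Ts(2) 2(2), of "\<lambda>x. x"] Ts(5) by simp
      then have "\<Sum>(Ts - {s}) = s" using add_self by (metis add_left_cancel)
      then show ?thesis using 2 Ts S(5) by (intro exI[of _ "Ts - {s}"]) (auto intro: inj_on_subset)
    next
      case 3
      then have "lam1 s \<notin> lam1 ` Ts" using lam1_Ts S(1) by blast
      then show ?thesis using 3 Ts S(1,5) by (intro exI[of _ "insert s Ts"]) auto
    next
      case 4
      then show ?thesis using S by blast
    qed
  qed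
  then show ?thesis using finite_C1 C1_neq_0 C1_in by (simp add: labelled_cover_def)
qed

text \<open>Nine groups give 18 labels, \<open>Xs\<close> gives one and \<open>YZs\<close>
  five.\<close>

lemma card_lam1: "card (lam1 ` C1) \<le> 24"
proof -
  have "lam1 ` C1 \<subseteq> (\<lambda>(u, b). (fvec u, 0, b)) ` (P \<times> UNIV) \<union> {0} \<times> {(0, True), (1, True), (1, False), (c, True), (c + 1, True), (d, True)}"
  proof (rule image_subsetI)
    fix s assume "s \<in> C1"
    then consider "s \<in> groups P" | "s \<in> Xs" | "s \<in> YZs" by (auto simp: C1_def)
    then show "lam1 s \<in> (\<lambda>(u, b). (fvec u, 0, b)) ` (P \<times> UNIV) \<union> {0} \<times> {(0, True), (1, True), (1, False), (c, True), (c + 1, True), (d, True)}"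
    proof cases
      case 1
      then obtain u x where "u \<in> P" "s = (fvec u, pt u x)" by (auto simp: groups_def)
      then show ?thesis using lam1_group[of u x] by (auto simp del: pt.simps)
    qed (auto simp: Xs_def YZs_def lam1_0)
  qed
  then have "card (lam1 ` C1) \<le> card ((\<lambda>(u, b). (fvec u, 0 :: gf, b :: bool)) ` (P \<times> UNIV) \<union> {0} \<times> {(0, True), (1, True), (1, False), (c, True), (c + 1, True), (d, True)})"
    using finite_P by (intro card_mono) auto
  also have "\<dots> \<le> card ((\<lambda>(u, b). (fvec u, 0 :: gf, b :: bool)) ` (P \<times> UNIV)) + card ({0 :: gf \<Rightarrow> bit} \<times> {(0, True), (1, True), (1, False), (c, True), (c + 1, True), (d, True)})"
    by (rule card_Un_le)
  also have "card ((\<lambda>(u, b). (fvec u, 0 :: gf, b :: bool)) ` (P \<times> UNIV)) \<le> 18"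
    using card_image_le[of "P \<times> UNIV" "\<lambda>(u, b). (fvec u, 0 :: gf, b :: bool)"] finite_P card_P
    by (simp add: card_cartesian_product)
  also have "card ({0 :: gf \<Rightarrow> bit} \<times> {(0, True), (1, True), (1, False), (c, True), (c + 1, True), (d, True)}) \<le> 6"
    using card_length[of "[(0, True), (1, True), (1, False), (c, True), (c + 1, True), (d, True)]"]
    by (subst card_cartesian_product) simp
  finally show ?thesis by simp
qed

end

subsection \<open>From coverings to parity-check matrices\<close>

text \<open>A finite elementary abelian 2-group, that is, a finite vector space over F_2, as a
  subset of a possibly larger type.\<close>

definition two_group :: "'a::ab_group_add set \<Rightarrow> bool" where
  "two_group V \<longleftrightarrow> finite V \<and> 0 \<in> V \<and> (\<forall>x\<in>V. \<forall>y\<in>V. x + y \<in> V) \<and> (\<forall>x\<in>V. x + x = 0)"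

definition phi :: "(nat \<Rightarrow> 'a::ab_group_add) \<Rightarrow> nat \<Rightarrow> (nat \<Rightarrow> bool) \<Rightarrow> 'a" where
  "phi b r v = (\<Sum>i<r. if v i then b i else 0)"

lemma phi_in:
  assumes "two_group V" "\<And>i. i < r \<Longrightarrow> b i \<in> V"
  shows "phi b r v \<in> V"
  using assms(2) unfolding phi_def
proof (induction r)
  case (Suc r)
  then show ?case using assms(1) by (auto simp: two_group_def)
qed (use assms(1) in \<open>simp add: two_group_def\<close>)

lemma phi_xor:
  assumes "two_group V" "\<And>i. i < r \<Longrightarrow> b i \<in> V"
  shows "phi b r (\<lambda>i. v i \<noteq> w i) = phi b r v + phi b r w"
  unfolding phi_def sum.distrib[symmetric]
  using assms by (intro sum.cong) (auto simp: two_group_def)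

lemma bij_vecs: "bij_betw (\<lambda>v. {i. v i}) (vecs r) (Pow {..<r})"
  by (rule bij_betwI[of _ _ _ "\<lambda>A i. i \<in> A"]) (auto simp: vecs_def not_le[symmetric])

lemma card_vecs: "card (vecs r) = 2 ^ r"
  using bij_betw_same_card[OF bij_vecs[of r]] by (simp add: card_Pow)

text \<open>Greedy choice: the span of k independent vectors has 2^k elements, so as long as this is
  less than \<open>card V\<close> some x lies outside. Two equal combinations that differ in the
  coefficient of x would put x into the span.\<close>

lemma ex_independent:
  assumes V: "two_group V" and "2 ^ k \<le> card V"
  shows "\<exists>b. (\<forall>i<k. b i \<in> V) \<and> inj_on (phi b k) (vecs k)"
  using assms(2)
proof (induction k)
  case 0
  then show ?case by (auto simp: vecs_def inj_on_def fun_eq_iff)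
next
  case (Suc k)
  then obtain b where b: "\<And>i. i < k \<Longrightarrow> b i \<in> V" "inj_on (phi b k) (vecs k)" by auto
  have "card (phi b k ` vecs k) < card V"
    using card_image[OF b(2)] card_vecs[of k] Suc.prems less_le_trans[of "2 ^ k" "2 ^ Suc k" "card V"] by simp
  moreover have "phi b k ` vecs k \<subseteq> V" using phi_in[where b = b and r = k, OF V b(1)] by blast
  ultimately obtain x where x: "x \<in> V" "x \<notin> phi b k ` vecs k"
    by (metis less_irrefl subsetI subset_antisym)
  define b' where "b' = b(k := x)"
  have phi': "phi b' (Suc k) v = phi b k (v(k := False)) + (if v k then x else 0)" for v
    unfolding phi_def b'_def by (auto intro!: sum.cong)
  have "inj_on (phi b' (Suc k)) (vecs (Suc k))"
  proof (rule inj_onI)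
    fix v w assume vw: "v \<in> vecs (Suc k)" "w \<in> vecs (Suc k)" and eq: "phi b' (Suc k) v = phi b' (Suc k) w"
    define v' where "v' = v(k := False)"
    define w' where "w' = w(k := False)"
    have "\<not> v i" "\<not> w i" if "k < i" for i
      using vw that by (auto simp: vecs_def Suc_le_eq)
    then have vw': "v' \<in> vecs k" "w' \<in> vecs k"
      by (auto simp: vecs_def v'_def w'_def order.order_iff_strict)
    then have "(\<lambda>i. v' i \<noteq> w' i) \<in> vecs k" by (auto simp: vecs_def)
    then have ne: "x \<noteq> phi b k v' + phi b k w'"
      using x(2) phi_xor[where b = b and r = k and v = v' and w = w', OF V b(1)] by (metis image_eqI)
    have dbl: "phi b k v' + phi b k v' = 0" "phi b k w' + phi b k w' = 0"
      using phi_in[where b = b and r = k, OF V b(1)] V by (auto simp: two_group_def)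
    have eq': "phi b k v' + (if v k then x else 0) = phi b k w' + (if w k then x else 0)"
      using eq by (simp add: phi' v'_def w'_def)
    have "v k = w k"
    proof (rule ccontr)
      assume "v k \<noteq> w k"
      then consider "phi b k v' + x = phi b k w'" | "phi b k v' = phi b k w' + x"
        using eq' by (cases "v k"; cases "w k") auto
      then have "x = phi b k v' + phi b k w'"
        by cases (metis dbl add.assoc add_0 add.commute)+
      then show False using ne by simp
    qed
    moreover have "v' = w'" using eq' \<open>v k = w k\<close> b(2) vw' by (auto simp: inj_on_def)
    moreover have "v = v'(k := v k)" "w = w'(k := w k)" by (simp_all add: v'_def w'_def)
    ultimately show "v = w" by simp
  qed
  moreover have "\<forall>i<Suc k. b' i \<in> V" using b(1) x(1) by (simp add: b'_def)
  ultimately show ?case by blast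
qed

lemma ex_basis:
  assumes V: "two_group V" and "card V = 2 ^ r"
  obtains b where "\<And>i. i < r \<Longrightarrow> b i \<in> V" "bij_betw (phi b r) (vecs r) V"
proof -
  obtain b where b: "\<And>i. i < r \<Longrightarrow> b i \<in> V" "inj_on (phi b r) (vecs r)"
    using ex_independent[OF V, of r] assms(2) by auto
  have "phi b r ` vecs r = V"
  proof (rule card_subset_eq)
    show "finite V" using V by (simp add: two_group_def)
    show "phi b r ` vecs r \<subseteq> V" using phi_in[where b = b and r = r, OF V b(1)] by blast
    show "card (phi b r ` vecs r) = card V"
      using card_image[OF b(2)] card_vecs[of r] assms(2) by simp
  qed
  then have "bij_betw (phi b r) (vecs r) V" using b(2) by (simp add: bij_betw_def)
  with b(1) show thesis by (rule that[of b])
qed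

lemma phi_colsum:
  assumes V: "two_group V" "\<And>i. i < r \<Longrightarrow> b i \<in> V" and "finite S"
  shows "phi b r (colsum H S) = (\<Sum>j\<in>S. phi b r (H j))"
  using assms(3)
proof (induction S rule: finite_induct)
  case empty
  then show ?case by (simp add: colsum_def phi_def)
next
  case (insert j S)
  have "colsum H (insert j S) = (\<lambda>i. H j i \<noteq> colsum H S i)"
  proof
    fix i
    have "{k \<in> insert j S. H k i} = (if H j i then insert j {k \<in> S. H k i} else {k \<in> S. H k i})" by auto
    then show "colsum H (insert j S) i = (H j i \<noteq> colsum H S i)"
      using insert.hyps by (simp add: colsum_def)
  qed
  then show ?case using insert phi_xor[where v = "H j" and w = "colsum H S", OF V] by simp
qed

lemma colsum_in_vecs:
  assumes "\<And>j. j \<in> S \<Longrightarrow> H j \<in> vecs r"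
  shows "colsum H S \<in> vecs r"
proof -
  have "{j \<in> S. H j i} = {}" if "r \<le> i" for i using assms that by (auto simp: vecs_def)
  then have "card {j \<in> S. H j i} = 0" if "r \<le> i" for i using that by (metis card.empty)
  then show ?thesis by (simp add: vecs_def colsum_def)
qed

lemma card_small_subsets: "card {S. S \<subseteq> {..<n} \<and> card S \<le> 3} \<le> (n + 1) ^ 3"
proof -
  \<comment> \<open>The entry \<open>n\<close> stands for a missing element and is removed by the
    intersection, so that smaller sets are coded by triples too.\<close>
  let ?f = "\<lambda>(a, b, c). {a, b, c} \<inter> {..<n}"
  let ?T = "{..n} \<times> {..n} \<times> {..n}"
  have "{S. S \<subseteq> {..<n} \<and> card S \<le> 3} \<subseteq> ?f ` ?T"
  proof safe
    fix S assume S: "S \<subseteq> {..<n}" "card S \<le> 3"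
    have fin: "finite S" using S(1) finite_subset by blast
    have "\<exists>a b c. a \<le> n \<and> b \<le> n \<and> c \<le> n \<and> S = {a, b, c} \<inter> {..<n}"
    proof -
      consider "S = {}" | "card S = 1" | "card S = 2" | "card S = 3" using S(2) fin
        by (metis One_nat_def Suc_1 card_0_eq le_SucE le_zero_eq numeral_3_eq_3)
      then show ?thesis
      proof cases
        case 1
        then show ?thesis by (intro exI[of _ n]) auto
      next
        case 2
        then obtain a where "S = {a}" using card_1_singletonE by blast
        then show ?thesis using S(1) by (intro exI[of _ a] exI[of _ n]) auto
      next
        case 3
        then obtain a b where "S = {a, b}" by (auto simp: card_2_iff)
        then show ?thesis using S(1) by (intro exI[of _ a] exI[of _ b] exI[of _ n]) auto
      next
        case 4
        then obtain a b c where "S = {a, b, c}" by (auto simp: card_3_iff)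
        then show ?thesis using S(1) by (intro exI[of _ a] exI[of _ b] exI[of _ c]) auto
      qed
    qed
    then show "S \<in> ?f ` ?T" by (auto simp: image_iff)
  qed
  then have "card {S. S \<subseteq> {..<n} \<and> card S \<le> 3} \<le> card (?f ` ?T)"
    by (intro card_mono) auto
  also have "\<dots> \<le> card ?T" by (rule card_image_le) auto
  also have "\<dots> = (n + 1) ^ 3" by (simp add: card_cartesian_product power3_eq_cube)
  finally show ?thesis .
qed

lemma not_covers_3:
  assumes "(n + 1) ^ 3 < 2 ^ r" "R < 4"
  shows "\<not> covers H n r R"
proof
  assume cov: "covers H n r R"
  have "vecs r \<subseteq> colsum H ` {S. S \<subseteq> {..<n} \<and> card S \<le> 3}"
  proof
    fix v assume "v \<in> vecs r"
    then obtain S where "S \<subseteq> {..<n}" "card S \<le> R" "colsum H S = v"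
      using cov by (auto simp: covers_def)
    then show "v \<in> colsum H ` {S. S \<subseteq> {..<n} \<and> card S \<le> 3}" using assms(2) by force
  qed
  moreover have fin: "finite {S. S \<subseteq> {..<n} \<and> card S \<le> 3}" by simp
  ultimately have "card (vecs r) \<le> card {S. S \<subseteq> {..<n} \<and> card S \<le> 3}"
    by (metis (no_types, lifting) card_image_le card_mono finite_imageI le_trans)
  then show False using card_small_subsets[of n] card_vecs[of r] assms(1) by simp
qed

text \<open>A basis identifies \<open>V\<close> with F_2^r; the elements of \<open>C\<close> become
  the columns in some order, the fibres of \<open>lam\<close> the parts. The columns are nonzero and
  distinct, so d >= 3, with equality by the triple. Counting excludes a radius below 4.\<close>

lemma code_of_cover:
  assumes cov: "labelled_cover V C lam l" and V: "two_group V" "card V = 2 ^ r" and n: "card C = n"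
    and T: "{x, y, z} \<subseteq> C" "x \<noteq> y" "x \<noteq> z" "y \<noteq> z" "x + y + z = 0"
    and small: "(n + 1) ^ 3 < 2 ^ r"
  shows "\<exists>H. is_code_RL H n r 3 4 l"
proof -
  have C: "finite C" "0 \<notin> C" "C \<subseteq> V" using cov by (auto simp: labelled_cover_def)
  obtain b where b: "\<And>i. i < r \<Longrightarrow> b i \<in> V" "bij_betw (phi b r) (vecs r) V"
    using ex_basis[OF V] by blast
  obtain e where e: "bij_betw e {..<n} C"
    using ex_bij_betw_nat_finite[OF C(1)] n by (auto simp: atLeast0LessThan)
  have inj_e: "inj_on e {..<n}" and eC: "\<And>j. j < n \<Longrightarrow> e j \<in> C" and e_im: "e ` {..<n} = C"
    using e by (auto simp: bij_betw_def)
  define H where "H j = inv_into (vecs r) (phi b r) (e j)" for j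
  have H: "H j \<in> vecs r" "phi b r (H j) = e j" if "j < n" for j
  proof -
    have "e j \<in> phi b r ` vecs r" using eC[OF that] C(3) b(2) by (auto simp: bij_betw_def)
    then show "H j \<in> vecs r" "phi b r (H j) = e j"
      unfolding H_def by (rule inv_into_into, rule f_inv_into_f)
  qed
  have col_in: "colsum H S \<in> vecs r" if "S \<subseteq> {..<n}" for S
    using that H(1) by (intro colsum_in_vecs) auto
  have col: "phi b r (colsum H S) = \<Sum>(e ` S)" if S: "S \<subseteq> {..<n}" for S
  proof -
    have "finite S" using S finite_subset by blast
    then have "phi b r (colsum H S) = (\<Sum>j\<in>S. phi b r (H j))"
      by (intro phi_colsum[where b = b and r = r, OF V(1) b(1)])
    also have "\<dots> = (\<Sum>j\<in>S. e j)" using S H(2) by (intro sum.cong) auto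
    also have "\<dots> = \<Sum>(e ` S)" using inj_on_subset[OF inj_e S] by (simp add: sum.reindex)
    finally show ?thesis .
  qed
  have col_eq: "colsum H S = v \<longleftrightarrow> \<Sum>(e ` S) = phi b r v" if "S \<subseteq> {..<n}" "v \<in> vecs r" for S v
    using inj_on_eq_iff[OF bij_betw_imp_inj_on[OF b(2)] col_in[OF that(1)] that(2)] col[OF that(1)] by simp
  have zero: "zero_vec \<in> vecs r" "phi b r zero_vec = 0"
    by (auto simp: zero_vec_def vecs_def phi_def)
  have pre: "\<exists>S\<subseteq>{..<n}. card S = card S' \<and> e ` S = S'" if "S' \<subseteq> C" for S'
    using that inj_e e_im by (metis card_image inj_on_subset subset_imageE)
  have rep: "\<exists>S\<subseteq>{..<n}. l \<le> card S \<and> card S \<le> 4 \<and> inj_on lam (e ` S) \<and> colsum H S = v"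
    if v: "v \<in> vecs r" for v
  proof -
    have "phi b r v \<in> V" using v b(2) by (auto simp: bij_betw_def)
    then obtain S' where S': "S' \<subseteq> C" "l \<le> card S'" "card S' \<le> 4" "inj_on lam S'" "\<Sum>S' = phi b r v"
      using cov by (auto simp: labelled_cover_def)
    then show ?thesis using pre[OF S'(1)] col_eq[OF _ v] by metis
  qed
  have "parity_check H n r"
    using H(1) rep unfolding parity_check_def by meson
  moreover have "has_covering_radius H n r 4"
    using rep not_covers_3[OF small] unfolding has_covering_radius_def covers_def by meson
  moreover have "has_min_dist H n 3"
    unfolding has_min_dist_def
  proof (intro conjI allI impI)
    fix S assume S: "S \<subseteq> {..<n}" "S \<noteq> {} \<and> colsum H S = zero_vec"
    have finS: "finite S" using S(1) finite_subset by blast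
    have eS: "\<Sum>(e ` S) = 0" "e ` S \<subseteq> C" "card (e ` S) = card S"
      using S col_eq[OF S(1) zero(1)] zero(2) eC inj_on_subset[OF inj_e S(1)] by (auto simp: card_image)
    show "3 \<le> card S"
    proof (rule ccontr)
      assume "\<not> 3 \<le> card S"
      moreover have "card S \<noteq> 0" using S(2) finS by simp
      ultimately consider "card S = 1" | "card S = 2" by linarith
      then show False
      proof cases
        case 1
        then obtain a where "e ` S = {a}" using eS(3) card_1_singletonE by metis
        then show False using eS C(2) by auto
      next
        case 2
        then obtain a a' where aa: "e ` S = {a, a'}" "a \<noteq> a'" using eS(3) by (metis card_2_iff)
        then have "a + a' = 0" using eS(1) by simp
        moreover have "a' + a' = 0" using aa eS(2) C(3) V(1) by (auto simp: two_group_def)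
        ultimately show False using aa(2) by (metis add_right_cancel)
      qed
    qed
  next
    obtain S where S: "S \<subseteq> {..<n}" "card S = card {x, y, z}" "e ` S = {x, y, z}"
      using pre[OF T(1)] by blast
    have "card S = 3" using S(2) T(2-4) by simp
    moreover have "\<Sum>(e ` S) = 0" unfolding S(3) using T(2-5) by (simp add: add.assoc)
    then have "colsum H S = zero_vec" using col_eq[OF S(1) zero(1)] zero(2) by simp
    ultimately show "\<exists>S\<subseteq>{..<n}. S \<noteq> {} \<and> card S = 3 \<and> colsum H S = zero_vec"
      using S(1) by (intro exI[of _ S]) auto
  qed
  moreover have "\<exists>P. RL_partition H n r 4 l P"
  proof -
    define P where "P = (\<lambda>a. {j \<in> {..<n}. lam (e j) = a}) ` lam ` C"
    have "is_partition_of P {..<n}"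
      using eC e_im unfolding is_partition_of_def P_def by (auto; blast)
    moreover have "\<not> (\<exists>B\<in>P. j \<in> B \<and> k \<in> B)"
      if "inj_on lam (e ` S)" "S \<subseteq> {..<n}" "j \<in> S" "k \<in> S" "j \<noteq> k" for S j k
    proof
      assume "\<exists>B\<in>P. j \<in> B \<and> k \<in> B"
      then have "lam (e j) = lam (e k)" by (auto simp: P_def)
      then have "e j = e k" using that by (auto simp: inj_on_def)
      then show False using inj_onD[OF inj_e, of j k] that(2-5) by blast
    qed
    ultimately have "RL_partition H n r 4 l P"
      using rep unfolding RL_partition_def by meson
    then show ?thesis ..
  qed
  ultimately show ?thesis unfolding is_code_RL_def by blast
qed

subsection \<open>The codes\<close>

lemma two_groupD:
  assumes "two_group V"
  shows "finite V" "0 \<in> V" "\<And>x y. x \<in> V \<Longrightarrow> y \<in> V \<Longrightarrow> x + y \<in> V" "\<And>x. x \<in> V \<Longrightarrow> x + x = 0"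
  using assms by (auto simp: two_group_def)

lemma two_group_times_pow4:
  assumes "two_group V" "gf_subfield K"
  shows "two_group (V \<times> pow4 K)" "card (V \<times> pow4 K) = card V * card K ^ 4"
  using assms subfieldD[OF assms(2)]
  by (auto simp: two_group_def pow4_def zero_prod_def card_cartesian_product power4_eq_xxxx)

lemma (in octic) two_group_V0: "two_group V0" and card_V0: "card V0 = 2 ^ 8"
proof -
  have finK: "finite K" using subfield_finite[OF K] .
  have bij: "bij_betw (\<lambda>g. {x. g x = 1}) V0 (Pow K)"
    by (rule bij_betwI[of _ _ _ "\<lambda>A x. of_bool (x \<in> A)"]) (auto simp: V0_def fun_eq_iff)
  show "card V0 = 2 ^ 8"
    using bij_betw_same_card[OF bij] card_K finK by (simp add: card_Pow)
  have "finite V0" using bij_betw_finite[OF bij] finK by simp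
  then show "two_group V0" by (auto simp: two_group_def V0_def)
qed

lemma ex_octic: "\<exists>c d. octic (GF 3) c d"
proof -
  have K: "gf_subfield (GF 3)" and card_K: "card (GF 3) = 8" by (simp_all add: subfield_GF card_GF)
  have "card {0, 1 :: gf} < card (GF 3)" by (simp add: card_K)
  then obtain c where c: "c \<in> GF 3" "c \<notin> {0, 1}"
    by (metis card_mono finite.emptyI finite.insertI linorder_not_less subsetI)
  have "card {0, 1, c, c + 1} < card (GF 3)"
    using card_length[of "[0, 1, c, c + 1]"] by (simp add: card_K)
  then obtain d where d: "d \<in> GF 3" "d \<notin> {0, 1, c, c + 1}"
    by (metis card_mono finite.emptyI finite.insertI linorder_not_less subsetI)
  let ?B = "{0, 1, c, c + 1, d, d + 1, c + d, c + d + 1}"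
  have "card ?B = 8"
  proof -
    \<comment> \<open>\<open>A\<close> is the span of 1 and c. It is disjoint from its coset d + A,
      which gives eight elements.\<close>
    define A where "A = {0, 1, c, c + 1}"
    have A: "card A = 4" "finite A" using c(2) by (auto simp: A_def)
    have closed: "x + y \<in> A" if "x \<in> A" "y \<in> A" for x y
      using that by (auto simp: A_def add_ac)
    have "A \<inter> (\<lambda>x. d + x) ` A = {}"
    proof (rule ccontr)
      assume "\<not> ?thesis"
      then obtain x where x: "x \<in> A" "d + x \<in> A" by blast
      have "d = (d + x) + x" by (simp add: add.assoc)
      then have "d \<in> A" using closed[OF x(2,1)] by simp
      then show False using d(2) by (simp add: A_def)
    qed
    then have "card (A \<union> (\<lambda>x. d + x) ` A) = 8"
      using A by (simp add: card_Un_disjoint card_image)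
    moreover have "A \<union> (\<lambda>x. d + x) ` A = ?B" by (auto simp: A_def add_ac)
    ultimately show ?thesis by simp
  qed
  moreover have "?B \<subseteq> GF 3"
    using c(1) d(1) subfield_intros[OF K] by auto
  ultimately have "GF 3 = ?B"
    using card_subset_eq[OF subfield_finite[OF K]] card_K by metis
  moreover have "x ^ 8 = x" if "x \<in> GF 3" for x using that by (simp add: GF_def)
  ultimately have "octic (GF 3) c d"
    using K card_K c d by unfold_locales auto
  then show ?thesis by blast
qed

lemma ex_generic_element:
  assumes "gf_subfield K" "2 < card K"
  obtains d where "d \<in> K" "d \<noteq> 0" "d \<noteq> 1"
proof -
  have "card {0, 1 :: gf} < card K" using assms(2) by simp
  then have "\<not> K \<subseteq> {0, 1}" using card_mono[of "{0, 1 :: gf}" K] by auto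
  then show thesis using that by blast
qed

text \<open>On a point attached to the zero column the multiples by 1, d and 1 + d add up to zero;
  this yields a codeword of weight 3.\<close>

lemma lift_triple:
  assumes K: "gf_subfield K" "2 < card K" and u: "u \<in> U"
  obtains x y z where "{x, y, z} \<subseteq> lift K U p C" "x \<noteq> y" "x \<noteq> z" "y \<noteq> z" "x + y + z = 0"
proof -
  obtain d where d: "d \<in> K" "d \<noteq> 0" "d \<noteq> 1" using ex_generic_element[OF K] .
  define g where "g x = (0 :: 'a, pt u x)" for x
  have g: "g x \<in> lift K U p C" if "x \<in> K" "x \<noteq> 0" for x
    using that u unfolding lift_def g_def by (intro UnI2) auto
  have inj: "g x = g y \<Longrightarrow> x = y" for x y by (auto simp: g_def dest: pt_inject)
  have d1: "1 + d \<in> K" "1 + d \<noteq> 0" "1 + d \<noteq> 1" "1 + d \<noteq> d"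
    using d subfield_intros[OF K(1)] by auto
  have "g 1 + g d + g (1 + d) = 0"
    by (simp add: g_def zero_prod_def del: pt.simps flip: pt_add)
  moreover have "{g 1, g d, g (1 + d)} \<subseteq> lift K U p C"
    using g[of 1] g[of d] g[of "1 + d"] d d1 subfield_1[OF K(1)] by auto
  moreover have "g 1 \<noteq> g d" "g 1 \<noteq> g (1 + d)" "g d \<noteq> g (1 + d)"
    using inj d d1 by metis+
  ultimately show thesis using that by blast
qed

lemma ex_cover_40:
  "\<exists>(V :: (((gf \<Rightarrow> bit) \<times> gf4) \<times> gf4) set) C (lam :: _ \<Rightarrow> gf option \<times> gf).
     two_group V \<and> card V = 2 ^ 40 \<and> labelled_cover V C lam 3 \<and> card C = 2942 \<and>
     card (lam ` C) \<le> 98 \<and> (\<exists>x y z. {x, y, z} \<subseteq> C \<and> x \<noteq> y \<and> x \<noteq> z \<and> y \<noteq> z \<and> x + y + z = 0)"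
proof -
  obtain c d where "octic (GF 3) c d" using ex_octic by blast
  then interpret octic "GF 3" c d .
  define V where "V = V0 \<times> pow4 (GF 3)"
  have V: "two_group V" "card V = 2 ^ 20"
    using two_group_times_pow4[OF two_group_V0 K] card_V0 card_K by (simp_all add: V_def)
  let ?K = "GF 5"
  have K5: "gf_subfield ?K" "card ?K = 32" by (simp_all add: subfield_GF card_GF)
  have fin5: "finite ?K" using subfield_finite[OF K5(1)] .
  \<comment> \<open>The at most 24 labels fit into the 31 nonzero elements; infinity and
    \<open>Some 0\<close> stay free for the zero column.\<close>
  have "card (Some ` (?K - {0})) = 31"
    using K5 fin5 subfield_0[OF K5(1)] by (simp add: card_image)
  then obtain g where g: "g ` lam1 ` C1 \<subseteq> Some ` (?K - {0})"
    "labelled_cover V C1 (\<lambda>s. g (lam1 s)) 2" "card ((\<lambda>s. g (lam1 s)) ` C1) = card (lam1 ` C1)"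
    using labelled_cover_relabel[OF C1_cover[folded V_def], of "Some ` (?K - {0})"] card_lam1 fin5 by auto
  define p where "p = (\<lambda>s. g (lam1 s))"
  have p: "labelled_cover V C1 p 2" "p ` C1 \<subseteq> Some ` (?K - {0})" "card (p ` C1) \<le> 24"
    using g card_lam1 by (auto simp: p_def)
  obtain d' where d': "d' \<in> ?K" "d' \<noteq> 0" "d' \<noteq> 1" using ex_generic_element[OF K5(1)] K5(2) by auto
  let ?C = "lift ?K {None, Some 0} p C1"
  note cov = lift_cover_2[OF K5(1) p(1) two_groupD(2,4)[OF V(1)] p(2) d']
  have "card ?C = 90 * 32 + 2 * 31"
    using card_lift[OF fin5 _ finite_C1 C1_neq_0 subfield_0[OF K5(1)], of "{None, Some 0}" p]
    by (simp add: card_C1 K5(2))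
  moreover have "two_group (V \<times> pow4 ?K)" "card (V \<times> pow4 ?K) = 2 ^ 40"
    using two_group_times_pow4[OF V(1) K5(1)] V(2) K5(2) by simp_all
  moreover have "card (label4 d' p ` ?C) \<le> 98" using cov(2) p(3) by simp
  moreover have "\<exists>x y z. {x, y, z} \<subseteq> ?C \<and> x \<noteq> y \<and> x \<noteq> z \<and> y \<noteq> z \<and> x + y + z = 0"
  proof (rule lift_triple[OF K5(1)])
    show "2 < card ?K" "None \<in> {None, Some 0}" using K5(2) by simp_all
  qed blast
  ultimately show ?thesis using cov(1)
    by (intro exI[of _ "V \<times> pow4 ?K"] exI[of _ ?C] exI[of _ "label4 d' p"]) simp
qed

lemma ex_code:
  assumes "t = 10 \<or> 17 \<le> t"
  shows "\<exists>H. is_code_RL H (2943 * 2 ^ (t - 10) - 1) (4 * t) 3 4 3"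
proof -
  obtain V :: "(((gf \<Rightarrow> bit) \<times> gf4) \<times> gf4) set" and C and lam :: "_ \<Rightarrow> gf option \<times> gf" and x y z
    where V: "two_group V" "card V = 2 ^ 40" and cov: "labelled_cover V C lam 3"
      and C: "card C = 2942" "card (lam ` C) \<le> 98"
      and T: "{x, y, z} \<subseteq> C" "x \<noteq> y" "x \<noteq> z" "y \<noteq> z" "x + y + z = 0"
    using ex_cover_40 by blast
  show ?thesis
  proof (cases "t = 10")
    case True
    then show ?thesis using code_of_cover[OF cov V C(1) T] by simp
  next
    case False
    define m where "m = t - 10"
    have m: "7 \<le> m" "t = 10 + m" using assms False by (auto simp: m_def)
    let ?K = "GF m"
    have K: "gf_subfield ?K" "card ?K = 2 ^ m" using m(1) by (simp_all add: subfield_GF card_GF)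
    have finK: "finite ?K" using subfield_finite[OF K(1)] .
    \<comment> \<open>At most 98 labels need distinct elements of \<open>GF m\<close>; hence m >= 7,
      that is, t >= 17.\<close>
    have "(2::nat) ^ 7 \<le> 2 ^ m" using m(1) by (intro power_increasing) auto
    then have q: "128 \<le> (2::nat) ^ m" by simp
    then have "card (lam ` C) \<le> card (Some ` ?K)" using C(2) K(2) by (simp add: card_image)
    then obtain g where g: "g ` lam ` C \<subseteq> Some ` ?K" "labelled_cover V C (\<lambda>s. g (lam s)) 3"
      "card ((\<lambda>s. g (lam s)) ` C) = card (lam ` C)"
      by (rule labelled_cover_relabel[OF cov finite_imageI[OF finK]])
    define p where "p = (\<lambda>s. g (lam s))"
    have p: "labelled_cover V C p 3" "p ` C \<subseteq> Some ` ?K" using g by (auto simp: p_def)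
    let ?C = "lift ?K {None} p C"
    have fC: "finite C" "0 \<notin> C" using cov by (auto simp: labelled_cover_def)
    have cov': "labelled_cover (V \<times> pow4 ?K) ?C (\<lambda>s. s) 3"
      by (rule lift_cover_3[OF K(1) p(1) two_groupD(2)[OF V(1)] p(2)])
    have V': "two_group (V \<times> pow4 ?K)" "card (V \<times> pow4 ?K) = 2 ^ (4 * t)"
      using two_group_times_pow4[OF V(1) K(1)] V(2) K(2) m(2)
      by (simp_all add: power_add power_mult[symmetric] mult.commute)
    have C': "card ?C = 2943 * 2 ^ (t - 10) - 1"
      using card_lift[OF finK _ fC subfield_0[OF K(1)], of "{None}" p] C(1) K(2) q
      by (simp add: m_def)
    obtain x y z where T: "{x, y, z} \<subseteq> ?C" "x \<noteq> y" "x \<noteq> z" "y \<noteq> z" "x + y + z = 0"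
    proof (rule lift_triple[OF K(1)])
      show "2 < card ?K" "None \<in> {None}" using K(2) q by simp_all
    qed
    have "(2943 * 2 ^ (t - 10) - 1 + 1) ^ 3 = (2943 ^ 3 * 2 ^ (3 * m) :: nat)"
      using q by (simp add: m_def power_mult_distrib power_mult[symmetric] mult.commute)
    also have "\<dots> < 2 ^ 40 * 2 ^ (3 * m)" by simp
    also have "\<dots> \<le> 2 ^ 40 * 2 ^ (4 * m)" by simp
    also have "\<dots> = 2 ^ (4 * t)" using m(2) by (simp add: power_add)
    finally have small: "(2943 * 2 ^ (t - 10) - 1 + 1) ^ 3 < (2 ^ (4 * t) :: nat)" .
    show ?thesis by (rule code_of_cover[OF cov' V' C' T small])
  qed
qed

section \<open>The covering density\<close>

lemma binomial_sum_4:
  "(\<Sum>i\<le>4. real (n choose i)) = 1 + real n + real n * (real n - 1) / 2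
     + real n * (real n - 1) * (real n - 2) / 6 + real n * (real n - 1) * (real n - 2) * (real n - 3) / 24"
proof -
  have choose: "real (n choose k) = (\<Prod>i<k. real n - real i) / fact k" for k
    by (simp add: binomial_gbinomial gbinomial_prod_rev atLeast0LessThan)
  show ?thesis unfolding choose by (simp add: numeral_eq_Suc lessThan_Suc atMost_Suc) (simp add: field_simps)?
qed

lemma density_limit:
  "(\<lambda>t::nat. (\<Sum>i\<le>4. real ((2943 * 2 ^ (t - 10) - 1) choose i)) / 2 ^ (4 * t))
     \<longlonglongrightarrow> 2943 ^ 4 / (3 * 2 ^ 43)"
proof -
  \<comment> \<open>\<open>h\<close> is the density in terms of x = 2^(t - 10), with n = 2943 x - 1.
    Its limit is the ratio of the leading coefficients, 2943^4 / 24 over 2^40.\<close>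
  define h :: "real \<Rightarrow> real" where "h x = (1 + (2943 * x - 1) + (2943 * x - 1) * (2943 * x - 2) / 2
    + (2943 * x - 1) * (2943 * x - 2) * (2943 * x - 3) / 6
    + (2943 * x - 1) * (2943 * x - 2) * (2943 * x - 3) * (2943 * x - 4) / 24) / (2 ^ 40 * x ^ 4)" for x
  have "(h \<longlongrightarrow> 2943 ^ 4 / (3 * 2 ^ 43)) at_top"
    unfolding h_def by real_asymp
  moreover have "filterlim (\<lambda>t::nat. 2 ^ (t - 10) :: real) at_top at_top"
    by real_asymp
  ultimately have "(\<lambda>t. h (2 ^ (t - 10))) \<longlonglongrightarrow> 2943 ^ 4 / (3 * 2 ^ 43)"
    by (rule filterlim_compose)
  moreover have "eventually (\<lambda>t. h (2 ^ (t - 10))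
      = (\<Sum>i\<le>4. real ((2943 * 2 ^ (t - 10) - 1) choose i)) / 2 ^ (4 * t)) sequentially"
    \<comment> \<open>From t = 10 on, the subtraction t - 10 is not truncated and 2^(4 t) is 2^40
      x^4.\<close>
    using eventually_ge_at_top[of 10]
  proof eventually_elim
    case (elim t)
    have "1 \<le> (2943 * 2 ^ (t - 10) :: nat)" by simp
    then have n: "real (2943 * 2 ^ (t - 10) - 1) = 2943 * 2 ^ (t - 10) - 1"
      by (simp add: of_nat_diff)
    have "(2::real) ^ (4 * t) = 2 ^ (40 + 4 * (t - 10))" using elim by simp
    then have "(2::real) ^ (4 * t) = 2 ^ 40 * (2 ^ (t - 10)) ^ 4"
      by (simp only: power_add power_mult[symmetric] mult.commute)
    then show ?case unfolding binomial_sum_4 n h_def by (simp add: algebra_simps)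
  qed
  ultimately show ?thesis by (rule Lim_transform_eventually)
qed

theorem theorem9p3:
  shows "(\<forall>t::nat. (t = 10 \<or> 17 \<le> t) \<longrightarrow>
            (\<exists>H. is_code_RL H (2943 * 2 ^ (t - 10) - 1) (4 * t) 3 4 3))
       \<and> (\<forall>t::nat. (t = 10 \<or> 17 \<le> t) \<longrightarrow> ell2 (4 * t) 4 \<le> 2943 * 2 ^ (t - 10) - 1)
       \<and> ((\<lambda>t::nat. (\<Sum>i\<le>4. real ((2943 * 2 ^ (t - 10) - 1) choose i)) / 2 ^ (4 * t))
            \<longlonglongrightarrow> 2943 ^ 4 / (3 * 2 ^ 43))"
proof (intro conjI allI impI)
  fix t :: nat assume t: "t = 10 \<or> 17 \<le> t"
  show "\<exists>H. is_code_RL H (2943 * 2 ^ (t - 10) - 1) (4 * t) 3 4 3"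
    by (rule ex_code[OF t])
  then show "ell2 (4 * t) 4 \<le> 2943 * 2 ^ (t - 10) - 1"
    unfolding ell2_def by (intro Least_le) (auto simp: is_code_RL_def)
qed (rule density_limit)

end
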